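(* Let $0<p<q$ and let $\mathcal F$ be a family of pairs $(f,g)$ of non-negative measurable functions on $\mathbb{R}^n$. Suppose that for all weights $w\in RH_{(\frac qp)'}$, $$\|f\|_{L^p(w)}\lesssim\|g\|_{L^p(w)},\qquad (f,g)\in\mathcal F.$$ Then for all $p(\cdot)\in\mathcal P_0$ such that $p<p_-\le p_+<q$ and $p(\cdot)\in LH$, $$\|f\|_{L^{p(\cdot)}}\lesssim\|g\|_{L^{p(\cdot)}},\qquad (f,g)\in\mathcal F.$$
   Context: Convention for inequalities over $\mathcal F$: an inequality $\|f\|_X\lesssim\|g\|_Y$, $(f,g)\in\mathcal F$, means that there is a constant $C$, independent of the pair, such that $\|f\|_X\le C\|g\|_Y$ for every $(f,g)\in\mathcal F$ with $\|f\|_X<\infty$. In the weighted hypothesis the constant depends on the weight $w$ only through its constant in the weight class, $[w]_{RH_{(q/p)'}}$, and not on $w$ itself. Weights: a weight is a non-negative locally integrable function $w$ with $0<w<\infty$ a.e. For $1<s<\infty$, $w\in RH_s$ if there is $C$ with $\left(\frac1{|Q|}\int_Q w^s\,dx\right)^{1/s}\le C\,\frac1{|Q|}\int_Q w\,dx$ for every cube $Q$ (sides parallel to the axes); the least such $C$ is $[w]_{RH_s}$. $s'$ is the conjugate exponent, $\frac1s+\frac1{s'}=1$. $\|f\|_{L^p(w)}=\left(\int_{\mathbb{R}^n}|f|^pw\,dx\right)^{1/p}$. Variable Lebesgue spaces: $\mathcal P_0$ is the set of measurable functions $p(\cdot):\mathbb{R}^n\to(0,\infty)$; $p_-=\operatorname{ess\,inf}_{x}p(x)$,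 $p_+=\operatorname{ess\,sup}_{x}p(x)$. $p(\cdot)\in LH$ means there are constants $C_0,C_\infty,p_\infty$ with $|p(x)-p(y)|\le\frac{C_0}{-\log(|x-y|)}$ for $|x-y|<\frac12$ and $|p(x)-p_\infty|\le\frac{C_\infty}{\log(e+|x|)}$ for all $x$. $\|f\|_{L^{p(\cdot)}}=\inf\left\{\lambda>0:\int_{\mathbb{R}^n}\left(\frac{|f(x)|}{\lambda}\right)^{p(x)}dx\le1\right\}$. *)

theory Defs
  imports "HOL-Analysis.Analysis" "HOL-Probability.Essential_Supremum"
begin

text \<open>
  Non-negative functions on \<open>\<real>\<^sup>n\<close> take values in \<^typ>\<open>ennreal\<close>, that is in \<open>[0,\<infinity>]\<close>; measurability
  and integration refer to Lebesgue measure.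
\<close>

text \<open>Powers \<open>x\<^sup>r\<close> of \<open>x \<in> [0,\<infinity>]\<close>; only used for exponents \<open>r > 0\<close>, so \<open>\<infinity>\<^sup>r = \<infinity>\<close> and \<open>0\<^sup>r = 0\<close>.\<close>

definition ennpow :: "ennreal \<Rightarrow> real \<Rightarrow> ennreal" where
  "ennpow x r = (if x = \<infinity> then \<infinity> else ennreal (enn2real x powr r))"

definition conj_exponent :: "real \<Rightarrow> real" where
  "conj_exponent s = s / (s - 1)"

lemma conj_exponent_iff:
  assumes "1 < s"
  shows "1 / s + 1 / t = 1 \<longleftrightarrow> t = conj_exponent s"
proof (cases "t = 0")
  case True
  then show ?thesis using assms by (auto simp: conj_exponent_def)
next
  case False
  then show ?thesis using assms by (auto simp: conj_exponent_def field_simps)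
qed

subsection \<open>Weights and reverse Hoelder classes\<close>

definition cubes :: "(real ^ 'n) set set" where
  "cubes = {cbox a (\<chi> i. a $ i + l) |a l. 0 < l}"

definition average :: "(real ^ 'n) set \<Rightarrow> (real ^ 'n \<Rightarrow> ennreal) \<Rightarrow> ennreal" where
  "average Q h = (\<integral>\<^sup>+x\<in>Q. h x \<partial>lebesgue) / emeasure lebesgue Q"

definition weight :: "(real ^ 'n \<Rightarrow> ennreal) \<Rightarrow> bool" where
  "weight w \<longleftrightarrow> w \<in> borel_measurable lebesgue
     \<and> (\<forall>K. compact K \<longrightarrow> (\<integral>\<^sup>+x\<in>K. w x \<partial>lebesgue) < \<infinity>)
     \<and> (AE x in lebesgue. 0 < w x \<and> w x < \<infinity>)"

definition RH_bound :: "real \<Rightarrow> (real ^ 'n \<Rightarrow> ennreal) \<Rightarrow> real \<Rightarrow> bool" where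
  "RH_bound s w C \<longleftrightarrow> 0 \<le> C \<and>
     (\<forall>Q\<in>cubes. ennpow (average Q (\<lambda>x. ennpow (w x) s)) (1 / s) \<le> ennreal C * average Q w)"

definition RH :: "real \<Rightarrow> (real ^ 'n \<Rightarrow> ennreal) set" where
  "RH s = {w. weight w \<and> (\<exists>C. RH_bound s w C)}"

definition RH_const :: "real \<Rightarrow> (real ^ 'n \<Rightarrow> ennreal) \<Rightarrow> real" where
  "RH_const s w = Inf {C. RH_bound s w C}"

text \<open>On \<open>RH s\<close> the infimum is attained, so \<^const>\<open>RH_const\<close> is the least admissible constant.\<close>

lemma RH_const_least:
  assumes "w \<in> RH s"
  shows "RH_bound s w (RH_const s w)"
    and "RH_bound s w C \<Longrightarrow> RH_const s w \<le> C"
proof -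
  let ?S = "{C. RH_bound s w C}"
  have bdd: "bdd_below ?S"
    by (rule bdd_belowI[of _ 0]) (auto simp: RH_bound_def)
  obtain C0 where C0: "RH_bound s w C0" and W: "weight w"
    using assms by (auto simp: RH_def)
  show "RH_bound s w C \<Longrightarrow> RH_const s w \<le> C"
    unfolding RH_const_def by (rule cInf_lower[OF _ bdd]) auto
  have nonneg: "0 \<le> RH_const s w"
    unfolding RH_const_def by (rule cInf_greatest) (use C0 in \<open>auto simp: RH_bound_def\<close>)
  show "RH_bound s w (RH_const s w)"
    unfolding RH_bound_def
  proof (intro conjI ballI nonneg)
    fix Q :: "(real ^ 'a) set"
    assume Q: "Q \<in> cubes"
    define A B where "A = ennpow (average Q (\<lambda>x. ennpow (w x) s)) (1 / s)" and "B = average Q w"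
    have AC: "A \<le> ennreal C * B" if "RH_bound s w C" for C
      using that Q by (auto simp: RH_bound_def A_def B_def)
    obtain a l where Qal: "Q = cbox a (\<chi> i. a $ i + l)" and l: "0 < l"
      using Q by (auto simp: cubes_def)
    have side: "((\<chi> i. a $ i + l) - a) \<bullet> b = l" if "b \<in> Basis" for b :: "real ^ 'a"
      using that by (auto simp: Basis_vec_def inner_axis)
    have "(\<Prod>b\<in>Basis. ((\<chi> i. a $ i + l) - a) \<bullet> b) > 0"
      using l by (intro prod_pos) (simp add: side)
    moreover have "\<forall>b\<in>Basis. a \<bullet> b \<le> (\<chi> i. a $ i + l) \<bullet> b"
      using side l by (force simp: inner_diff_left)
    ultimately have "emeasure lebesgue Q \<noteq> 0"
      unfolding Qal by (auto simp: emeasure_lborel_cbox_eq ennreal_eq_0_iff not_le)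
    moreover have "(\<integral>\<^sup>+x\<in>Q. w x \<partial>lebesgue) < \<infinity>"
      using W by (auto simp: weight_def Qal)
    ultimately have "B \<noteq> \<infinity>"
      by (auto simp: B_def average_def ennreal_divide_eq_top_iff)
    then obtain b where b: "B = ennreal b" "0 \<le> b"
      by (cases B) auto
    have "A \<noteq> \<infinity>"
      using AC[OF C0] b by (auto simp: ennreal_mult_eq_top_iff top_unique)
    then obtain a' where a': "A = ennreal a'" "0 \<le> a'"
      by (cases A) auto
    have le: "a' \<le> C * b" if "RH_bound s w C" for C
    proof -
      have "0 \<le> C" using that by (simp add: RH_bound_def)
      then show ?thesis using AC[OF that] a' b by (simp flip: ennreal_mult)
    qed
    have "a' \<le> RH_const s w * b"
    proof (cases "b = 0")
      case True
      then show ?thesis using le[OF C0] by simp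
    next
      case False
      have "a' / b \<le> RH_const s w"
        unfolding RH_const_def
        by (rule cInf_greatest) (use C0 le False b in \<open>auto simp: divide_simps\<close>)
      then show ?thesis using False b by (simp add: divide_simps)
    qed
    then show "ennpow (average Q (\<lambda>x. ennpow (w x) s)) (1 / s) \<le> ennreal (RH_const s w) * average Q w"
      using a' b nonneg by (simp add: A_def[symmetric] B_def[symmetric] flip: ennreal_mult)
  qed
qed

subsection \<open>Weighted and variable Lebesgue spaces\<close>

definition weighted_norm :: "real \<Rightarrow> (real ^ 'n \<Rightarrow> ennreal) \<Rightarrow> (real ^ 'n \<Rightarrow> ennreal) \<Rightarrow> ennreal" where
  "weighted_norm p w f = ennpow (\<integral>\<^sup>+x. ennpow (f x) p * w x \<partial>lebesgue) (1 / p)"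

definition exponents0 :: "(real ^ 'n \<Rightarrow> real) set" where
  "exponents0 = {p. p \<in> borel_measurable lebesgue \<and> (\<forall>x. 0 < p x)}"

definition p_plus :: "(real ^ 'n \<Rightarrow> real) \<Rightarrow> ereal" where
  "p_plus p = esssup lebesgue (\<lambda>x. ereal (p x))"

definition p_minus :: "(real ^ 'n \<Rightarrow> real) \<Rightarrow> ereal" where
  "p_minus p = - esssup lebesgue (\<lambda>x. - ereal (p x))"

definition LH :: "(real ^ 'n \<Rightarrow> real) set" where
  "LH = {p. (\<exists>C0. \<forall>x y. x \<noteq> y \<and> norm (x - y) < 1 / 2
                 \<longrightarrow> \<bar>p x - p y\<bar> \<le> C0 / (- ln (norm (x - y))))
          \<and> (\<exists>Cinf pinf. \<forall>x. \<bar>p x - pinf\<bar> \<le> Cinf / ln (exp 1 + norm x))}"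

text \<open>The Luxemburg norm; it is \<open>\<infinity>\<close> if no \<open>\<lambda>\<close> is admissible.\<close>

definition variable_norm :: "(real ^ 'n \<Rightarrow> real) \<Rightarrow> (real ^ 'n \<Rightarrow> ennreal) \<Rightarrow> ennreal" where
  "variable_norm p f =
     Inf {ennreal l |l. 0 < l \<and> (\<integral>\<^sup>+x. ennpow (f x / ennreal l) (p x) \<partial>lebesgue) \<le> 1}"

text \<open>
  \<open>X f \<le> C \<cdot> Y g\<close> for all pairs of the family with \<open>X f < \<infinity>\<close>, the constant being explicit so that
  its dependence on other data can be expressed.
\<close>

definition family_bound ::
  "('f \<times> 'g) set \<Rightarrow> ('f \<Rightarrow> ennreal) \<Rightarrow> ('g \<Rightarrow> ennreal) \<Rightarrow> real \<Rightarrow> bool" where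
  "family_bound \<F> X Y C \<longleftrightarrow>
     0 < C \<and> (\<forall>(f, g)\<in>\<F>. X f < \<infinity> \<longrightarrow> X f \<le> ennreal C * Y g)"

end

theory Submission
  imports Defs
begin

text \<open>
  Write \<open>s = (q / p)'\<close> and \<open>\<beta>(x) = 1 - p / r(x)\<close>, so that \<open>1 / \<beta>\<close> is the exponent conjugate to \<open>r / p\<close>. The argument is
  duality with explicit test functions. If the modular \<open>\<integral>f\<^sup>r\<close> is comparable to \<open>1\<close>, then \<open>h = f\<^sup>r\<^sup>-\<^sup>p\<close> satisfies
  \<open>\<integral>f\<^sup>p h = \<integral>f\<^sup>r\<close>, and the power \<open>1 / \<beta>\<close> of \<open>h\<close> is \<open>f\<^sup>r\<close> again. Suppose that \<open>h\<close> has a majorant \<open>w\<close> in \<open>RH\<^sub>s\<close>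
  for which the power \<open>1 / \<beta>\<close> is still integrable. Then the hypothesis can be applied to \<open>w\<close>. On the left,
  \<open>\<integral>f\<^sup>p w\<close> is at least \<open>\<integral>f\<^sup>r\<close> (\<open>duality_lower_bound\<close>); on the right, \<open>\<integral>g\<^sup>p w\<close> is at most the sum of the
  modular of \<open>g\<close> and the integral of the power \<open>1 / \<beta>\<close> of \<open>w\<close> (\<open>duality_upper_bound\<close>), and the norm inequality follows.
  The same upper bound applied to \<open>f\<close> gives the finiteness of its weighted norm.

  The constant in the hypothesis is an arbitrary function of the constant of the weight, so the proof tests with one
  weight only. If the conclusion fails, there are pairs \<open>(f\<^sub>k, g\<^sub>k)\<close> that violate it with constants \<open>c\<^sub>k\<close>,
  \<open>c\<^sub>k\<^sup>p = 4\<^sup>k\<close>. Normalise them and put all their test functions into one integrable series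
  \<open>H = \<Sum> 2\<^sup>-\<^sup>k f\<^sub>k\<^sup>r\<close>. A single weight \<open>w\<close> whose power \<open>1 / \<beta>\<close> majorises \<open>H\<close> then tests all pairs
  with one and the same constant; the loss of \<open>2\<^sup>k\<close> against the gain of \<open>4\<^sup>k\<close> is a contradiction.

  It remains to find, for an integrable \<open>H\<close>, a weight \<open>w\<close> in \<open>RH\<^sub>s\<close> whose power \<open>1 / \<beta>\<close> is integrable and dominates
  \<open>H\<close> up to a constant (\<open>reverse_hoelder_majorant\<close>). As \<open>r\<close> stays below a number smaller than \<open>q\<close>,
  there is an upper bound \<open>b\<^sub>1\<close> of \<open>\<beta>\<close> for which \<open>\<gamma> = s b\<^sub>1\<close> is less than \<open>1\<close>. The maximal operator is bounded on the Lebesgue space with constant exponent \<open>1 / \<gamma>\<close>, and the iteration of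
  Rubio de Francia yields an \<open>A\<^sub>1\<close> function \<open>Z \<ge> H\<^sup>\<gamma>\<close> in that space (\<open>A1_majorant\<close>). The variable exponent enters
  afterwards: put \<open>u = Z\<^sup>\<sigma>\<close> with \<open>\<sigma>(x) = \<beta>(x) / b\<^sub>1\<close> where \<open>Z \<ge> 1\<close>, and use the limit of \<open>\<sigma>\<close> at
  infinity as the exponent where \<open>Z < 1\<close>. The local log-Hoelder condition makes \<open>u\<close> an \<open>A\<^sub>1\<close> function (\<open>A1_variable_power\<close>), because
  means of \<open>Z\<close> over small cubes are at most of the order of the reciprocal of the volume. The condition at infinity makes the
  power \<open>1 / (\<gamma> \<sigma>)\<close> of \<open>u\<close> comparable to the power \<open>1 / \<gamma>\<close> of \<open>Z\<close>, because \<open>Z\<close> cannot decay faster than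
  \<open>|x|\<^sup>-\<^sup>n\<close>. Finally \<open>w\<close> is the power \<open>1 / s\<close> of \<open>u\<close>: on every cube the mean of \<open>w\<^sup>s = u\<close> is bounded by a multiple of almost
  every value of \<open>u\<close> there, which is stronger than the reverse Hoelder inequality for \<open>w\<close> (\<open>RH_bound_of_A1\<close>).
\<close>

section \<open>Extended powers and the layer cake formula\<close>

lemma ennpow_ennreal: "0 \<le> x \<Longrightarrow> ennpow (ennreal x) r = ennreal (x powr r)"
  by (simp add: ennpow_def)

lemma ennpow_top [simp]: "ennpow \<infinity> r = \<infinity>"  "ennpow top r = top"
  by (simp_all add: ennpow_def)

lemma ennpow_0 [simp]: "ennpow 0 r = 0"
  by (simp add: ennpow_def)

lemma ennpow_1 [simp]: "ennpow x 1 = x"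
  by (cases x) (auto simp: ennpow_def)

lemma ennpow_mono:
  assumes "x \<le> y" "0 \<le> r"
  shows "ennpow x r \<le> ennpow y r"
  using assms
  by (cases x; cases y) (auto simp: ennpow_def ennreal_le_iff2 top_unique intro!: powr_mono2 ennreal_leI)

lemma ennpow_ennpow: "ennpow (ennpow x r) t = ennpow x (r * t)"
  by (cases x) (auto simp: ennpow_def powr_powr)

lemma ennpow_mult:
  assumes "0 < r"
  shows "ennpow (x * y) r = ennpow x r * ennpow y r"
proof (cases "x = 0 \<or> y = 0 \<or> x = top \<or> y = top")
  case True
  then show ?thesis
    by (cases x; cases y) (auto simp: ennpow_def ennreal_mult_top ennreal_top_mult ennreal_mult_eq_top_iff)
next
  case False
  then obtain a b where "x = ennreal a" "0 \<le> a" "y = ennreal b" "0 \<le> b"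
    by (cases x; cases y) auto
  then show ?thesis
    by (simp add: ennpow_ennreal powr_mult flip: ennreal_mult)
qed

lemma borel_measurable_ennpow [measurable (raw)]:
  fixes f :: "'a \<Rightarrow> ennreal" and r :: "'a \<Rightarrow> real"
  assumes [measurable]: "f \<in> borel_measurable M" "r \<in> borel_measurable M"
  shows "(\<lambda>x. ennpow (f x) (r x)) \<in> borel_measurable M"
  unfolding ennpow_def by measurable

lemma sigma_finite_lebesgue: "sigma_finite_measure (lebesgue :: 'a::euclidean_space measure)"
proof
  obtain A :: "'a set set" where A: "countable A" "A \<subseteq> sets lborel" "\<Union> A = space lborel"
      "\<forall>a\<in>A. emeasure lborel a \<noteq> \<infinity>"
    using lborel.sigma_finite_countable[where 'a='a] by metis
  show "\<exists>A. countable A \<and> A \<subseteq> sets lebesgue \<and> \<Union> A = space (lebesgue :: 'a measure)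
      \<and> (\<forall>a\<in>A. emeasure lebesgue a \<noteq> \<infinity>)"
    using A by (intro exI[of _ A]) auto
qed

lemma ennreal_top_unique_bound:
  fixes y :: ennreal
  assumes "\<And>N. ennreal N \<le> y"
  shows "y = top"
proof (cases y)
  case (real c)
  with assms[of "c + 1"] show ?thesis by simp
qed

text \<open>
  The case \<open>y = \<infinity>\<close> is included because maximal functions may take the value \<open>\<infinity>\<close>.
\<close>

lemma nn_integral_powr_below:
  fixes y :: ennreal and a :: real
  assumes a: "-1 < a"
  shows "(\<integral>\<^sup>+t. ennreal (t powr a) * indicator {t. 0 \<le> t \<and> ennreal t < y} t \<partial>lborel)
    = ennreal (1 / (a + 1)) * ennpow y (a + 1)"
proof -
  have real_case: "(\<integral>\<^sup>+t. ennreal (t powr a) * indicator {t. 0 \<le> t \<and> ennreal t < ennreal c} t \<partial>lborel)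
    = ennreal (1 / (a + 1)) * ennreal (c powr (a + 1))" if c: "0 \<le> c" for c
  proof -
    have "(\<integral>\<^sup>+t. ennreal (t powr a) * indicator {t. 0 \<le> t \<and> ennreal t < ennreal c} t \<partial>lborel)
      = (\<integral>\<^sup>+t. ennreal (indicator {0..c} t * t powr a) \<partial>lborel)"
    proof (rule nn_integral_cong_AE)
      show "AE t in lborel. ennreal (t powr a) * indicator {t. 0 \<le> t \<and> ennreal t < ennreal c} t
          = ennreal (indicator {0..c} t * t powr a)"
        using AE_lborel_singleton[of c]
        by eventually_elim (auto simp: indicator_def ennreal_less_iff)
    qed
    also have "\<dots> = ennreal (c powr (a + 1) / (a + 1))"
      by (rule nn_integral_has_integral_lebesgue[OF _ has_integral_powr_from_0[OF a c]]) auto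
    also have "\<dots> = ennreal (1 / (a + 1)) * ennreal (c powr (a + 1))"
      using a by (simp flip: ennreal_mult)
    finally show ?thesis .
  qed
  show ?thesis
  proof (cases y)
    case (real c)
    then show ?thesis using real_case[of c] by (simp add: ennpow_ennreal)
  next
    case top
    let ?I = "\<integral>\<^sup>+t. ennreal (t powr a) * indicator {t. 0 \<le> t \<and> ennreal t < y} t \<partial>lborel"
    have "ennreal N \<le> ?I" if N: "0 < N" for N
    proof -
      \<comment> \<open>the truncation point at which the integral equals \<open>N\<close>\<close>
      define c where "c = ((a + 1) * N) powr (1 / (a + 1))"
      have "ennreal N = ennreal (1 / (a + 1)) * ennreal (c powr (a + 1))"
        using a N by (simp add: c_def powr_powr flip: ennreal_mult)
      also have "\<dots> \<le> ?I"
        unfolding real_case[of c, symmetric, unfolded c_def, simplified, folded c_def] top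
        by (rule nn_integral_mono) (auto simp: indicator_def)
      finally show ?thesis .
    qed
    then have "ennreal N \<le> ?I" for N
      by (cases "0 < N") (auto simp: ennreal_neg)
    then have "?I = top"
      by (rule ennreal_top_unique_bound)
    then show ?thesis using top a by (simp add: ennreal_mult_top)
  qed
qed

text \<open>
  Both sides integrate \<open>w x \<cdot> e t\<^sup>e\<^sup>-\<^sup>1\<close> over the region \<open>0 \<le> t < F x\<close>, so this is Tonelli's theorem. The factor \<open>w\<close>
  allows the same identity to be used backwards in the strong type estimate below, where it is the
  function itself.
\<close>

lemma nn_integral_ennpow_layer_cake:
  fixes F :: "'a \<Rightarrow> ennreal" and e :: real
  assumes M: "sigma_finite_measure M" and e: "0 < e"
    and F [measurable]: "F \<in> borel_measurable M"
    and D: "w \<in> borel_measurable M"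
  shows "(\<integral>\<^sup>+x. w x * ennpow (F x) e \<partial>M)
    = ennreal e * (\<integral>\<^sup>+t. ennreal (t powr (e - 1)) *
        (\<integral>\<^sup>+x. w x * indicator {x. ennreal t < F x} x \<partial>M) * indicator {0..} t \<partial>lborel)"
proof -
  note D [measurable]
  interpret M: sigma_finite_measure M by fact
  interpret P: pair_sigma_finite M lborel ..
  have "(\<integral>\<^sup>+x. w x * ennpow (F x) e \<partial>M)
    = (\<integral>\<^sup>+x. (\<integral>\<^sup>+t. ennreal e * (w x * (ennreal (t powr (e - 1)) * indicator {t. 0 \<le> t \<and> ennreal t < F x} t)) \<partial>lborel) \<partial>M)"
    (is "_ = (\<integral>\<^sup>+x. (\<integral>\<^sup>+t. ?g x t \<partial>lborel) \<partial>M)")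
  proof (rule nn_integral_cong)
    fix x
    have "w x * ennpow (F x) e = ennreal e * (w x * (ennreal (1 / e) * ennpow (F x) e))"
    proof -
      have "ennreal e * ennreal (1 / e) = 1" using e by (simp flip: ennreal_mult)
      moreover have "ennreal e * (w x * (ennreal (1 / e) * ennpow (F x) e))
          = (ennreal e * ennreal (1 / e)) * (w x * ennpow (F x) e)"
        by (simp only: ac_simps)
      ultimately show ?thesis by simp
    qed
    then show "w x * ennpow (F x) e = (\<integral>\<^sup>+t. ?g x t \<partial>lborel)"
      using nn_integral_powr_below[of "e - 1" "F x"] e by (simp add: nn_integral_cmult)
  qed
  also have "\<dots> = (\<integral>\<^sup>+t. (\<integral>\<^sup>+x. ?g x t \<partial>M) \<partial>lborel)"
    by (rule P.Fubini'[symmetric]) measurable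
  also have "\<dots> = (\<integral>\<^sup>+t. ennreal e * (ennreal (t powr (e - 1)) *
        (\<integral>\<^sup>+x. w x * indicator {x. ennreal t < F x} x \<partial>M) * indicator {0..} t) \<partial>lborel)"
  proof (rule nn_integral_cong)
    fix t :: real
    have "(\<integral>\<^sup>+x. ?g x t \<partial>M) = (\<integral>\<^sup>+x. (ennreal e * ennreal (t powr (e - 1)) * indicator {0..} t) *
        (w x * indicator {x. ennreal t < F x} x) \<partial>M)"
      by (intro nn_integral_cong) (auto simp: indicator_def ac_simps)
    also have "\<dots> = (ennreal e * ennreal (t powr (e - 1)) * indicator {0..} t) *
        (\<integral>\<^sup>+x. w x * indicator {x. ennreal t < F x} x \<partial>M)"
      by (rule nn_integral_cmult) measurable
    finally show "(\<integral>\<^sup>+x. ?g x t \<partial>M) = ennreal e * (ennreal (t powr (e - 1)) *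
        (\<integral>\<^sup>+x. w x * indicator {x. ennreal t < F x} x \<partial>M) * indicator {0..} t)"
      by (simp add: ac_simps)
  qed
  also have "\<dots> = ennreal e * (\<integral>\<^sup>+t. ennreal (t powr (e - 1)) *
        (\<integral>\<^sup>+x. w x * indicator {x. ennreal t < F x} x \<partial>M) * indicator {0..} t \<partial>lborel)"
    by (rule nn_integral_cmult) measurable
  finally show ?thesis .
qed

section \<open>The Hardy-Littlewood maximal function\<close>

text \<open>The uncentred maximal function over open balls; its level sets are unions of such balls, hence open.\<close>

definition hl_maximal :: "('a::euclidean_space \<Rightarrow> ennreal) \<Rightarrow> 'a \<Rightarrow> ennreal" where
  "hl_maximal \<phi> x = (SUP (y, r)\<in>{(y, r). x \<in> ball y r}.
     (\<integral>\<^sup>+z\<in>ball y r. \<phi> z \<partial>lebesgue) / emeasure lebesgue (ball y r))"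

lemma emeasure_lebesgue_ball:
  "0 \<le> r \<Longrightarrow> emeasure lebesgue (ball (y::'a::euclidean_space) r) = ennreal (unit_ball_vol (DIM('a)) * r ^ DIM('a))"
  by (simp add: emeasure_ball)

lemma emeasure_lebesgue_ball_pos:
  "0 < r \<Longrightarrow> 0 < emeasure lebesgue (ball (y::'a::euclidean_space) r)"
  by (simp add: emeasure_lebesgue_ball unit_ball_vol_pos del: emeasure_completion)

lemma hl_maximal_level_set:
  "{x. t < hl_maximal \<phi> x} = (\<Union>(y, r)\<in>{(y, r). t < (\<integral>\<^sup>+z\<in>ball y r. \<phi> z \<partial>lebesgue) / emeasure lebesgue (ball y r)}. ball y r)"
proof (intro set_eqI)
  fix x
  have "x \<in> {x. t < hl_maximal \<phi> x} \<longleftrightarrow> (\<exists>i\<in>{(y, r). x \<in> ball y r}.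
      t < (case i of (y, r) \<Rightarrow> (\<integral>\<^sup>+z\<in>ball y r. \<phi> z \<partial>lebesgue) / emeasure lebesgue (ball y r)))"
    unfolding hl_maximal_def less_SUP_iff by simp
  also have "\<dots> \<longleftrightarrow> (\<exists>y r. x \<in> ball y r \<and>
      t < (\<integral>\<^sup>+z\<in>ball y r. \<phi> z \<partial>lebesgue) / emeasure lebesgue (ball y r))"
    by (simp add: Bex_def split_paired_Ex)
  finally show "x \<in> {x. t < hl_maximal \<phi> x} \<longleftrightarrow> x \<in> (\<Union>(y, r)\<in>{(y, r). t < (\<integral>\<^sup>+z\<in>ball y r. \<phi> z \<partial>lebesgue) / emeasure lebesgue (ball y r)}. ball y r)"
    unfolding UN_iff by (simp add: Bex_def split_paired_Ex conj_commute)
qed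

lemma open_hl_maximal_level_set: "open {x. t < hl_maximal \<phi> x}"
  unfolding hl_maximal_level_set by auto

lemma hl_maximal_level_set_lebesgue [measurable]: "{x. t < hl_maximal \<phi> x} \<in> sets lebesgue"
  by (intro sets_completionI_sets) (simp add: borel_open open_hl_maximal_level_set)

lemma borel_measurable_hl_maximal: "hl_maximal \<phi> \<in> borel_measurable borel"
  by (rule borel_measurableI_greater) (simp add: open_hl_maximal_level_set)

lemma borel_measurable_hl_maximal_lebesgue [measurable]: "hl_maximal \<phi> \<in> borel_measurable lebesgue"
  by (intro measurable_completion) (simp add: borel_measurable_hl_maximal)

lemma hl_maximal_ge:
  assumes "x \<in> ball y r"
  shows "(\<integral>\<^sup>+z\<in>ball y r. \<phi> z \<partial>lebesgue) \<le> hl_maximal \<phi> x * emeasure lebesgue (ball y r)"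
proof -
  have r: "0 < r" using assms by (metis empty_iff ball_empty not_le)
  let ?v = "emeasure lebesgue (ball y r)"
  have "(\<integral>\<^sup>+z\<in>ball y r. \<phi> z \<partial>lebesgue) / ?v \<le> hl_maximal \<phi> x"
    unfolding hl_maximal_def by (rule SUP_upper2[of "(y, r)"]) (use assms in auto)
  then have "(\<integral>\<^sup>+z\<in>ball y r. \<phi> z \<partial>lebesgue) / ?v * ?v \<le> hl_maximal \<phi> x * ?v"
    by (rule mult_right_mono) simp
  moreover have "0 < ?v" "?v < top"
    using r emeasure_lebesgue_ball_pos[OF r] emeasure_lebesgue_ball[of r y] by auto
  ultimately show ?thesis
    by (simp add: ennreal_divide_times less_top)
qed

lemma emeasure_UN_countable_le:
  assumes C: "countable C" and A [measurable]: "\<And>j. j \<in> C \<Longrightarrow> A j \<in> sets M"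
  shows "emeasure M (\<Union>j\<in>C. A j) \<le> (\<integral>\<^sup>+j. emeasure M (A j) \<partial>count_space C)"
proof -
  have [measurable]: "(\<Union>j\<in>C. A j) \<in> sets M"
    using C A by (rule sets.countable_UN'')
  have "emeasure M (\<Union>j\<in>C. A j) = (\<integral>\<^sup>+x. indicator (\<Union>j\<in>C. A j) x \<partial>M)"
    by simp
  also have "\<dots> \<le> (\<integral>\<^sup>+x. (\<integral>\<^sup>+j. indicator (A j) x \<partial>count_space C) \<partial>M)"
  proof (rule nn_integral_mono)
    fix x
    show "indicator (\<Union>j\<in>C. A j) x \<le> (\<integral>\<^sup>+j. indicator (A j) x \<partial>count_space C)"
    proof (cases "x \<in> (\<Union>j\<in>C. A j)")
      case True
      then obtain j where j: "j \<in> C" "x \<in> A j" by auto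
      then have "indicator (A j) x \<le> (\<integral>\<^sup>+j. indicator (A j) x \<partial>count_space C)"
        by (intro nn_integral_ge_point)
      then show ?thesis using True j by simp
    qed simp
  qed
  also have "\<dots> = (\<integral>\<^sup>+j. (\<integral>\<^sup>+x. indicator (A j) x \<partial>M) \<partial>count_space C)"
    using C by (rule nn_integral_count_space_nn_integral) simp
  also have "\<dots> = (\<integral>\<^sup>+j. emeasure M (A j) \<partial>count_space C)"
    by (intro nn_integral_cong) simp
  finally show ?thesis .
qed

text \<open>
  Each point of the level set lies in a ball on which the mean of \<open>\<phi>\<close> exceeds \<open>t\<close>. Vitali's lemma
  selects disjoint balls among them whose fivefold dilates still cover the level set; this costs the
  factor \<open>5\<^sup>n\<close>, and over disjoint balls the integrals of \<open>\<phi>\<close> add up to at most the total integral. The radii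
  are bounded, as Vitali's lemma requires, because \<open>t |B| \<le> \<integral>\<phi> < \<infinity>\<close> on each such ball.
\<close>

lemma hl_maximal_weak_type:
  fixes \<phi> :: "'a::euclidean_space \<Rightarrow> ennreal"
  assumes \<phi> [measurable]: "\<phi> \<in> borel_measurable lebesgue" and t: "0 < t"
  shows "ennreal t * emeasure lebesgue {x. ennreal t < hl_maximal \<phi> x}
    \<le> 5 ^ DIM('a) * (\<integral>\<^sup>+x. \<phi> x \<partial>lebesgue)"
proof (cases "\<integral>\<^sup>+x. \<phi> x \<partial>lebesgue")
  case top
  then show ?thesis by (simp add: ennreal_mult_top)
next
  case (real I)
  define K where "K = {(y :: 'a, r). ennreal t < (\<integral>\<^sup>+z\<in>ball y r. \<phi> z \<partial>lebesgue) / emeasure lebesgue (ball y r)}"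
  define \<omega> where "\<omega> = unit_ball_vol (real DIM('a))"
  have \<omega>: "0 < \<omega>" by (simp add: \<omega>_def unit_ball_vol_pos)
  have K: "0 < snd i" "ennreal t * emeasure lebesgue (ball (fst i) (snd i)) \<le> (\<integral>\<^sup>+z\<in>ball (fst i) (snd i). \<phi> z \<partial>lebesgue)"
    if i: "i \<in> K" for i
  proof -
    obtain y r where i': "i = (y, r)" by (cases i)
    let ?v = "emeasure lebesgue (ball y r)"
    have less: "ennreal t < (\<integral>\<^sup>+z\<in>ball y r. \<phi> z \<partial>lebesgue) / ?v"
      using i by (simp add: K_def i' del: emeasure_completion)
    show r: "0 < snd i"
    proof (rule ccontr)
      assume "\<not> 0 < snd i"
      then have "ball y r = {}" by (simp add: i')
      with less show False by simp
    qed
    have "ennreal t * ?v \<le> (\<integral>\<^sup>+z\<in>ball y r. \<phi> z \<partial>lebesgue) / ?v * ?v"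
      using less by (intro mult_right_mono) auto
    also have "\<dots> = (\<integral>\<^sup>+z\<in>ball y r. \<phi> z \<partial>lebesgue)"
    proof -
      have "0 < ?v" "?v < top"
        using r emeasure_lebesgue_ball_pos[of r y] emeasure_lebesgue_ball[of r y] by (auto simp: i')
      then show ?thesis by (simp add: ennreal_divide_times less_top)
    qed
    finally show "ennreal t * emeasure lebesgue (ball (fst i) (snd i)) \<le> (\<integral>\<^sup>+z\<in>ball (fst i) (snd i). \<phi> z \<partial>lebesgue)"
      by (simp add: i')
  qed
  have bound: "0 < snd i \<and> snd i \<le> max 1 (I / (t * \<omega>))" if i: "i \<in> K" for i
  proof (intro conjI K(1)[OF i])
    have "ennreal t * emeasure lebesgue (ball (fst i) (snd i)) \<le> ennreal I"
    proof (rule order.trans[OF K(2)[OF i]])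
      show "(\<integral>\<^sup>+z\<in>ball (fst i) (snd i). \<phi> z \<partial>lebesgue) \<le> ennreal I"
        unfolding real(2)[symmetric] by (intro nn_integral_mono) (auto simp: indicator_def)
    qed
    then have "t * (\<omega> * snd i ^ DIM('a)) \<le> I"
      using t K(1)[OF i] \<omega> real(1)
      by (simp add: emeasure_lebesgue_ball \<omega>_def[symmetric] del: emeasure_completion flip: ennreal_mult)
    then have "snd i ^ DIM('a) \<le> I / (t * \<omega>)"
      using t \<omega> by (simp add: field_simps)
    moreover have "snd i \<le> snd i ^ DIM('a)" if "1 \<le> snd i"
      using that by (intro self_le_power) auto
    ultimately show "snd i \<le> max 1 (I / (t * \<omega>))" by linarith
  qed
  obtain C where C: "countable C" "C \<subseteq> K"
     "pairwise (\<lambda>i j. disjnt (cball (fst i) (snd i)) (cball (fst j) (snd j))) C"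
     and cover: "\<And>i. i \<in> K \<Longrightarrow> \<exists>j. j \<in> C \<and> \<not> disjnt (cball (fst i) (snd i)) (cball (fst j) (snd j))
        \<and> cball (fst i) (snd i) \<subseteq> ball (fst j) (5 * snd j)"
    using Vitali_covering_lemma_cballs_balls[where a = fst and r = snd and K = K, OF bound] by blast
  have disj: "disjoint_family_on (\<lambda>j. ball (fst j) (snd j)) C"
    unfolding disjoint_family_on_def
  proof (intro ballI impI)
    fix i j assume "i \<in> C" "j \<in> C" "i \<noteq> j"
    then have "disjnt (cball (fst i) (snd i)) (cball (fst j) (snd j))"
      using C(3) by (auto simp: pairwise_def)
    then show "ball (fst i) (snd i) \<inter> ball (fst j) (snd j) = {}"
      by (meson ball_subset_cball disjnt_subset1 disjnt_subset2 disjnt_def)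
  qed
  have "{x. ennreal t < hl_maximal \<phi> x} \<subseteq> (\<Union>j\<in>C. ball (fst j) (5 * snd j))"
  proof
    fix x assume "x \<in> {x. ennreal t < hl_maximal \<phi> x}"
    then obtain i where i: "i \<in> K" "x \<in> ball (fst i) (snd i)"
      unfolding hl_maximal_level_set K_def by fastforce
    then show "x \<in> (\<Union>j\<in>C. ball (fst j) (5 * snd j))"
      using cover[OF i(1)] ball_subset_cball by blast
  qed
  then have "emeasure lebesgue {x. ennreal t < hl_maximal \<phi> x}
      \<le> emeasure lebesgue (\<Union>j\<in>C. ball (fst j) (5 * snd j))"
    by (intro emeasure_mono) (auto intro!: sets.countable_UN'' C(1))
  also have "\<dots> \<le> (\<integral>\<^sup>+j. emeasure lebesgue (ball (fst j) (5 * snd j)) \<partial>count_space C)"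
    using C(1) by (intro emeasure_UN_countable_le) auto
  finally have "ennreal t * emeasure lebesgue {x. ennreal t < hl_maximal \<phi> x}
      \<le> ennreal t * (\<integral>\<^sup>+j. emeasure lebesgue (ball (fst j) (5 * snd j)) \<partial>count_space C)"
    by (intro mult_left_mono) auto
  also have "\<dots> = (\<integral>\<^sup>+j. ennreal t * emeasure lebesgue (ball (fst j) (5 * snd j)) \<partial>count_space C)"
    by (rule nn_integral_cmult[symmetric]) auto
  also have "\<dots> \<le> (\<integral>\<^sup>+j. 5 ^ DIM('a) * (\<integral>\<^sup>+z\<in>ball (fst j) (snd j). \<phi> z \<partial>lebesgue) \<partial>count_space C)"
  proof (rule nn_integral_mono)
    fix j assume "j \<in> space (count_space C)"
    then have j: "j \<in> K" using C(2) by auto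
    have "emeasure lebesgue (ball (fst j) (5 * snd j)) = 5 ^ DIM('a) * emeasure lebesgue (ball (fst j) (snd j))"
    proof -
      have "ennreal (unit_ball_vol (real DIM('a)) * (5 * snd j) ^ DIM('a))
          = ennreal (5 ^ DIM('a)) * ennreal (unit_ball_vol (real DIM('a)) * snd j ^ DIM('a))"
        using K(1)[OF j] by (subst ennreal_mult[symmetric]) (auto simp: power_mult_distrib mult_ac)
      then show ?thesis
        using K(1)[OF j] by (simp add: emeasure_lebesgue_ball del: emeasure_completion flip: ennreal_power)
    qed
    then have "ennreal t * emeasure lebesgue (ball (fst j) (5 * snd j))
        = 5 ^ DIM('a) * (ennreal t * emeasure lebesgue (ball (fst j) (snd j)))"
      by (simp only: ac_simps)
    also have "\<dots> \<le> 5 ^ DIM('a) * (\<integral>\<^sup>+z\<in>ball (fst j) (snd j). \<phi> z \<partial>lebesgue)"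
      by (intro mult_left_mono K(2) j) auto
    finally show "ennreal t * emeasure lebesgue (ball (fst j) (5 * snd j)) \<le> \<dots>" .
  qed
  also have "\<dots> = 5 ^ DIM('a) * (\<integral>\<^sup>+j. (\<integral>\<^sup>+z\<in>ball (fst j) (snd j). \<phi> z \<partial>lebesgue) \<partial>count_space C)"
    by (rule nn_integral_cmult) auto
  also have "(\<integral>\<^sup>+j. (\<integral>\<^sup>+z\<in>ball (fst j) (snd j). \<phi> z \<partial>lebesgue) \<partial>count_space C)
      = (\<integral>\<^sup>+j. emeasure (density lebesgue \<phi>) (ball (fst j) (snd j)) \<partial>count_space C)"
    by (intro nn_integral_cong) (simp add: emeasure_density)
  also have "\<dots> = emeasure (density lebesgue \<phi>) (\<Union>j\<in>C. ball (fst j) (snd j))"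
    using C(1) disj by (intro emeasure_UN_countable[symmetric]) auto
  also have "\<dots> \<le> emeasure (density lebesgue \<phi>) (space (density lebesgue \<phi>))"
    by (rule emeasure_space)
  also have "\<dots> = (\<integral>\<^sup>+x. \<phi> x \<partial>lebesgue)"
    by (simp add: emeasure_density)
  finally show ?thesis by (simp add: mult_left_mono)
qed

text \<open>
  The part of \<open>\<phi>\<close> below \<open>s\<close> has means at most \<open>s\<close>. Taking \<open>s = t / 2\<close> reduces the level \<open>t\<close> of the maximal
  function to the part of \<open>\<phi>\<close> above \<open>t / 2\<close>, which turns the weak type bound into the strong one.
\<close>

lemma hl_maximal_le_truncation:
  fixes \<phi> :: "'a::euclidean_space \<Rightarrow> ennreal"
  assumes [measurable]: "\<phi> \<in> borel_measurable lebesgue" and s: "s < top"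
  shows "hl_maximal \<phi> x \<le> s + hl_maximal (\<lambda>z. \<phi> z * indicator {z. s < \<phi> z} z) x"
  unfolding hl_maximal_def[of \<phi>]
proof (rule SUP_least, clarify)
  fix y :: 'a and r assume x: "x \<in> ball y r"
  let ?\<psi> = "\<lambda>z. \<phi> z * indicator {z. s < \<phi> z} z" and ?v = "emeasure lebesgue (ball y r)"
  have r: "0 < r" using x by (metis empty_iff ball_empty not_le)
  have v: "0 < ?v" "?v < top"
    using r emeasure_lebesgue_ball_pos[of r y] emeasure_lebesgue_ball[of r y] by auto
  have [measurable]: "ball y r \<in> sets lebesgue" by simp
  have "(\<integral>\<^sup>+z\<in>ball y r. \<phi> z \<partial>lebesgue)
      \<le> (\<integral>\<^sup>+z. s * indicator (ball y r) z + ?\<psi> z * indicator (ball y r) z \<partial>lebesgue)"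
    by (intro nn_integral_mono) (auto simp: indicator_def)
  also have "\<dots> = s * ?v + (\<integral>\<^sup>+z\<in>ball y r. ?\<psi> z \<partial>lebesgue)"
    by (subst nn_integral_add, measurable) (simp add: nn_integral_cmult_indicator)
  also have "\<dots> \<le> s * ?v + hl_maximal ?\<psi> x * ?v"
    by (intro add_left_mono hl_maximal_ge x)
  finally have "(\<integral>\<^sup>+z\<in>ball y r. \<phi> z \<partial>lebesgue) \<le> (s + hl_maximal ?\<psi> x) * ?v"
    by (simp add: distrib_right)
  then have "(\<integral>\<^sup>+z\<in>ball y r. \<phi> z \<partial>lebesgue) / ?v \<le> (s + hl_maximal ?\<psi> x) * ?v / ?v"
    by (rule divide_right_mono_ennreal)
  also have "\<dots> = s + hl_maximal ?\<psi> x"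
    using v by (simp add: ennreal_mult_divide_eq less_top)
  finally show "(\<integral>\<^sup>+z\<in>ball y r. \<phi> z \<partial>lebesgue) / ?v \<le> s + hl_maximal ?\<psi> x" .
qed

text \<open>
  By truncation and the weak type bound, \<open>t |{M\<phi> > t}|\<close> is at most \<open>2 \<cdot> 5\<^sup>n\<close> times the integral of \<open>\<phi>\<close> over
  \<open>{2\<phi> > t}\<close>. Multiplying by \<open>e t\<^sup>e\<^sup>-\<^sup>2\<close> and integrating in \<open>t\<close>, the left side becomes the integral of \<open>(M\<phi>)\<^sup>e\<close> and
  the right side a multiple of the integral of \<open>\<phi> (2\<phi>)\<^sup>e\<^sup>-\<^sup>1\<close>; integrability of \<open>t\<^sup>e\<^sup>-\<^sup>2\<close> at \<open>0\<close> is where \<open>e > 1\<close> enters.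
\<close>

lemma hl_maximal_strong_type:
  fixes \<phi> :: "'a::euclidean_space \<Rightarrow> ennreal"
  assumes \<phi> [measurable]: "\<phi> \<in> borel_measurable lebesgue" and e: "1 < e"
  shows "(\<integral>\<^sup>+x. ennpow (hl_maximal \<phi> x) e \<partial>lebesgue)
    \<le> ennreal (e * 2 * 5 ^ DIM('a) * 2 powr (e - 1) / (e - 1)) * (\<integral>\<^sup>+x. ennpow (\<phi> x) e \<partial>lebesgue)"
proof -
  define L where "L t = (\<integral>\<^sup>+z. \<phi> z * indicator {z. ennreal t < 2 * \<phi> z} z \<partial>lebesgue)" for t
  have L_meas: "L \<in> borel_measurable borel"
    unfolding L_def using sigma_finite_measure.borel_measurable_nn_integral[OF sigma_finite_lebesgue, where N = borel
      and f = "\<lambda>t z. \<phi> z * indicator {z. ennreal t < 2 * \<phi> z} z"]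
    by measurable
  have level: "ennreal t * emeasure lebesgue {x. ennreal t < hl_maximal \<phi> x} \<le> ennreal (2 * 5 ^ DIM('a)) * L t"
    if t: "0 < t" for t
  proof -
    let ?s = "ennreal (t / 2)"
    let ?\<psi> = "\<lambda>z. \<phi> z * indicator {z. ?s < \<phi> z} z"
    have tss: "ennreal t = ?s + ?s"
      using t by (simp flip: ennreal_plus)
    have sub: "{x. ennreal t < hl_maximal \<phi> x} \<subseteq> {x. ?s < hl_maximal ?\<psi> x}"
    proof safe
      fix x assume "ennreal t < hl_maximal \<phi> x"
      also have "\<dots> \<le> ?s + hl_maximal ?\<psi> x"
        by (rule hl_maximal_le_truncation) auto
      finally show "?s < hl_maximal ?\<psi> x"
        unfolding tss by (simp add: ennreal_add_left_cancel_less)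
    qed
    have "ennreal t * emeasure lebesgue {x. ennreal t < hl_maximal \<phi> x}
        \<le> ennreal t * emeasure lebesgue {x. ?s < hl_maximal ?\<psi> x}"
      by (intro mult_left_mono emeasure_mono sub hl_maximal_level_set_lebesgue) auto
    also have "\<dots> = 2 * (?s * emeasure lebesgue {x. ?s < hl_maximal ?\<psi> x})"
      unfolding tss by (simp add: distrib_right mult_2 del: emeasure_completion)
    also have "\<dots> \<le> 2 * (5 ^ DIM('a) * (\<integral>\<^sup>+x. ?\<psi> x \<partial>lebesgue))"
      using t by (intro mult_left_mono hl_maximal_weak_type) auto
    also have "(\<integral>\<^sup>+x. ?\<psi> x \<partial>lebesgue) = L t"
    proof -
      have "?s < \<phi> z \<longleftrightarrow> ennreal t < 2 * \<phi> z" for z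
        using t by (cases "\<phi> z") (auto simp: ennreal_less_iff ennreal_mult_top simp flip: ennreal_numeral ennreal_mult)
      then show ?thesis by (simp add: L_def)
    qed
    finally show ?thesis
      by (simp add: ennreal_mult mult.assoc flip: ennreal_power)
  qed
  have "(\<integral>\<^sup>+x. ennpow (hl_maximal \<phi> x) e \<partial>lebesgue)
    = ennreal e * (\<integral>\<^sup>+t. ennreal (t powr (e - 1)) *
        (\<integral>\<^sup>+x. 1 * indicator {x. ennreal t < hl_maximal \<phi> x} x \<partial>lebesgue) * indicator {0..} t \<partial>lborel)"
    using nn_integral_ennpow_layer_cake[OF sigma_finite_lebesgue, of e "hl_maximal \<phi>" "\<lambda>_. 1"] e
    by simp
  also have "\<dots> \<le> ennreal e * (\<integral>\<^sup>+t. ennreal (2 * 5 ^ DIM('a)) *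
        (ennreal (t powr (e - 1 - 1)) * L t * indicator {0..} t) \<partial>lborel)"
  proof (intro mult_left_mono nn_integral_mono)
    fix t :: real
    let ?E = "emeasure lebesgue {x. ennreal t < hl_maximal \<phi> x}"
    have "ennreal (t powr (e - 1)) * ?E \<le> ennreal (t powr (e - 1 - 1)) * (ennreal (2 * 5 ^ DIM('a)) * L t)"
      if t: "0 < t"
    proof -
      have "t powr (e - 1) = t powr (e - 1 - 1) * t"
        using t by (simp add: powr_diff field_simps power2_eq_square)
      then have "ennreal (t powr (e - 1)) * ?E = ennreal (t powr (e - 1 - 1)) * (ennreal t * ?E)"
        using t by (simp add: ennreal_mult mult.assoc del: emeasure_completion)
      also have "\<dots> \<le> ennreal (t powr (e - 1 - 1)) * (ennreal (2 * 5 ^ DIM('a)) * L t)"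
        by (intro mult_left_mono level t) auto
      finally show ?thesis .
    qed
    moreover have "(\<integral>\<^sup>+x. 1 * indicator {x. ennreal t < hl_maximal \<phi> x} x \<partial>lebesgue) = ?E"
      by (simp del: emeasure_completion)
    ultimately show "ennreal (t powr (e - 1)) * (\<integral>\<^sup>+x. 1 * indicator {x. ennreal t < hl_maximal \<phi> x} x \<partial>lebesgue) * indicator {0..} t
      \<le> ennreal (2 * 5 ^ DIM('a)) * (ennreal (t powr (e - 1 - 1)) * L t * indicator {0..} t)"
      by (cases t "0 :: real" rule: linorder_cases) (simp_all only: indicator_simps atLeast_iff, simp_all add: ac_simps del: emeasure_completion)
  qed auto
  also have "\<dots> = ennreal e * (ennreal (2 * 5 ^ DIM('a)) * (\<integral>\<^sup>+t.
        (ennreal (t powr (e - 1 - 1)) * L t * indicator {0..} t) \<partial>lborel))"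
    using L_meas by (subst nn_integral_cmult) auto
  also have "(\<integral>\<^sup>+t. (ennreal (t powr (e - 1 - 1)) * L t * indicator {0..} t) \<partial>lborel)
      = ennreal (1 / (e - 1)) * (\<integral>\<^sup>+x. \<phi> x * ennpow (2 * \<phi> x) (e - 1) \<partial>lebesgue)"
  proof -
    let ?J = "\<integral>\<^sup>+t. (ennreal (t powr (e - 1 - 1)) * L t * indicator {0..} t) \<partial>lborel"
    have "(\<integral>\<^sup>+x. \<phi> x * ennpow (2 * \<phi> x) (e - 1) \<partial>lebesgue) = ennreal (e - 1) * ?J"
      unfolding L_def using e by (intro nn_integral_ennpow_layer_cake sigma_finite_lebesgue) auto
    then have "ennreal (1 / (e - 1)) * (\<integral>\<^sup>+x. \<phi> x * ennpow (2 * \<phi> x) (e - 1) \<partial>lebesgue)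
        = (ennreal (1 / (e - 1)) * ennreal (e - 1)) * ?J"
      by (simp add: mult.assoc)
    also have "ennreal (1 / (e - 1)) * ennreal (e - 1) = 1"
      using e by (simp flip: ennreal_mult)
    finally show ?thesis by simp
  qed
  also have "(\<integral>\<^sup>+x. \<phi> x * ennpow (2 * \<phi> x) (e - 1) \<partial>lebesgue)
      = (\<integral>\<^sup>+x. ennreal (2 powr (e - 1)) * ennpow (\<phi> x) e \<partial>lebesgue)"
  proof (rule nn_integral_cong)
    fix x
    show "\<phi> x * ennpow (2 * \<phi> x) (e - 1) = ennreal (2 powr (e - 1)) * ennpow (\<phi> x) e"
    proof (cases "\<phi> x")
      case (real c)
      have "c * (2 * c) powr (e - 1) = 2 powr (e - 1) * c powr e"
        using real(1) e by (cases "c = 0") (auto simp: powr_mult powr_diff)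
      moreover have "2 * ennreal c = ennreal (2 * c)"
        using real(1) by (simp add: ennreal_mult)
      ultimately show ?thesis
        using real by (simp add: ennpow_ennreal flip: ennreal_mult)
    qed (use e in \<open>simp add: ennreal_mult_top\<close>)
  qed
  also have "\<dots> = ennreal (2 powr (e - 1)) * (\<integral>\<^sup>+x. ennpow (\<phi> x) e \<partial>lebesgue)"
    by (rule nn_integral_cmult) measurable
  finally show ?thesis
    using e by (simp add: ennreal_mult divide_inverse mult_ac)
qed

section \<open>Majorants in the class \<open>A\<^sub>1\<close>\<close>

lemma ennreal_suminf_half: "(\<Sum>k. ennreal ((1/2) ^ k)) = 2"
proof -
  have "(\<Sum>k. ennreal ((1/2) ^ k)) = ennreal (\<Sum>k. (1/2) ^ k)"
    by (rule suminf_ennreal2) auto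
  then show ?thesis by (simp add: suminf_geometric)
qed

lemma ennreal_le_suminf:
  fixes f :: "nat \<Rightarrow> ennreal"
  shows "f k \<le> (\<Sum>k. f k)"
  using sum_le_suminf[of f "{k}"] by simp

lemma ennreal_suminf_Suc_le:
  fixes f :: "nat \<Rightarrow> ennreal"
  shows "(\<Sum>k. f (Suc k)) \<le> (\<Sum>k. f k)"
proof (rule suminf_le_const)
  fix n
  have "(\<Sum>k<n. f (Suc k)) \<le> (\<Sum>k<Suc n. f k)"
    by (simp add: sum.lessThan_Suc_shift del: sum.lessThan_Suc)
  also have "\<dots> \<le> (\<Sum>k. f k)"
    by (rule sum_le_suminf) auto
  finally show "(\<Sum>k<n. f (Suc k)) \<le> (\<Sum>k. f k)" .
qed simp

text \<open>
  The function is \<open>\<Phi> = \<Sum> (4A)\<^sup>-\<^sup>k M\<^sup>k \<psi>\<close>, where \<open>A\<close> bounds the operator \<open>M\<close> on the \<open>e\<close>-th powers. Applying \<open>M\<close> shifts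
  the series by one place, so that \<open>M \<Phi> \<le> 4A \<Phi>\<close> pointwise, and the coefficients decay fast enough for \<open>\<Phi>\<close> to stay
  in \<open>L\<^sup>e\<close>. The term \<open>k = 0\<close> gives \<open>\<psi> \<le> \<Phi>\<close>.
\<close>

lemma rubio_de_francia:
  fixes \<psi> :: "'a::euclidean_space \<Rightarrow> ennreal"
  assumes \<psi> [measurable]: "\<psi> \<in> borel_measurable lebesgue" and e: "1 < e"
    and fin: "(\<integral>\<^sup>+x. ennpow (\<psi> x) e \<partial>lebesgue) < \<infinity>"
  obtains \<Phi> B where "\<Phi> \<in> borel_measurable lebesgue" "\<And>x. \<psi> x \<le> \<Phi> x"
    "(\<integral>\<^sup>+x. ennpow (\<Phi> x) e \<partial>lebesgue) < \<infinity>" "1 \<le> B"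
    "\<And>x y r. x \<in> ball y r \<Longrightarrow>
       (\<integral>\<^sup>+z\<in>ball y r. \<Phi> z \<partial>lebesgue) \<le> ennreal B * emeasure lebesgue (ball y r) * \<Phi> x"
proof -
  \<comment> \<open>the maximum with \<open>1\<close> makes the coefficients \<open>d k\<close> below at most \<open>1\<close>\<close>
  define A where "A = max 1 (e * 2 * 5 ^ DIM('a) * 2 powr (e - 1) / (e - 1))"
  have A: "1 \<le> A" by (simp add: A_def)
  define Mk where "Mk k = (hl_maximal ^^ k) \<psi>" for k
  have Mk_meas [measurable]: "Mk k \<in> borel_measurable lebesgue" for k
    by (cases k) (simp_all add: Mk_def)
  define I where "I = (\<integral>\<^sup>+x. ennpow (\<psi> x) e \<partial>lebesgue)"
  have Mk_int: "(\<integral>\<^sup>+x. ennpow (Mk k x) e \<partial>lebesgue) \<le> ennreal (A ^ k) * I" for k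
  proof (induction k)
    case 0
    then show ?case by (simp add: Mk_def I_def)
  next
    case (Suc k)
    have "(\<integral>\<^sup>+x. ennpow (Mk (Suc k) x) e \<partial>lebesgue)
        \<le> ennreal (e * 2 * 5 ^ DIM('a) * 2 powr (e - 1) / (e - 1)) * (\<integral>\<^sup>+x. ennpow (Mk k x) e \<partial>lebesgue)"
      using hl_maximal_strong_type[OF Mk_meas e, of k] by (simp add: Mk_def)
    also have "\<dots> \<le> ennreal A * (ennreal (A ^ k) * I)"
      by (intro mult_mono Suc.IH ennreal_leI) (auto simp: A_def)
    also have "\<dots> = ennreal (A ^ Suc k) * I"
      using A by (simp add: ennreal_mult mult.assoc)
    finally show ?case .
  qed
  define d where "d k = (1 / (2 * A)) ^ k" for k
  have d: "0 < d k" "d k \<le> 1" "d k * A ^ k = (1/2) ^ k" for k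
  proof -
    show "0 < d k" "d k * A ^ k = (1/2) ^ k"
      using A by (auto simp: d_def power_divide power_mult_distrib)
    show "d k \<le> 1"
      unfolding d_def using A by (intro power_le_one) auto
  qed
  define \<Phi> where "\<Phi> x = (\<Sum>k. ennreal ((1/2) ^ k) * (ennreal (d k) * Mk k x))" for x
  have \<Phi>_meas [measurable]: "\<Phi> \<in> borel_measurable lebesgue"
    unfolding \<Phi>_def by measurable
  have lower: "\<psi> x \<le> \<Phi> x" for x
    using ennreal_le_suminf[of "\<lambda>k. ennreal ((1/2) ^ k) * (ennreal (d k) * Mk k x)" 0]
    by (simp add: \<Phi>_def d_def Mk_def)
  have int: "(\<integral>\<^sup>+x. ennpow (\<Phi> x) e \<partial>lebesgue) < \<infinity>"
  proof -
    \<comment> \<open>\<open>T\<close> dominates the supremum of the \<open>e\<close>-th powers of the terms \<open>d k M\<^sup>k \<psi>\<close>, and the weights \<open>2\<^sup>-\<^sup>k\<close> sum to \<open>2\<close>\<close>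
    define T where "T x = (\<Sum>k. ennpow (ennreal (d k) * Mk k x) e)" for x
    have pw: "ennpow (\<Phi> x) e \<le> ennpow 2 e * T x" for x
    proof -
      have term_le: "ennreal (d k) * Mk k x \<le> ennpow (T x) (1 / e)" for k
      proof -
        have "ennreal (d k) * Mk k x = ennpow (ennpow (ennreal (d k) * Mk k x) e) (1 / e)"
          using e by (simp add: ennpow_ennpow)
        also have "\<dots> \<le> ennpow (T x) (1 / e)"
          unfolding T_def using e by (intro ennpow_mono ennreal_le_suminf) auto
        finally show ?thesis .
      qed
      have "\<Phi> x \<le> (\<Sum>k. ennreal ((1/2) ^ k) * ennpow (T x) (1 / e))"
        unfolding \<Phi>_def by (intro suminf_le mult_left_mono term_le) auto
      also have "\<dots> = 2 * ennpow (T x) (1 / e)"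
        by (simp only: ennreal_suminf_multc ennreal_suminf_half)
      finally have "ennpow (\<Phi> x) e \<le> ennpow (2 * ennpow (T x) (1 / e)) e"
        using e by (intro ennpow_mono) auto
      also have "\<dots> = ennpow 2 e * T x"
        using e by (simp add: ennpow_mult ennpow_ennpow)
      finally show ?thesis .
    qed
    have "(\<integral>\<^sup>+x. ennpow (\<Phi> x) e \<partial>lebesgue) \<le> (\<integral>\<^sup>+x. ennpow 2 e * T x \<partial>lebesgue)"
      by (intro nn_integral_mono pw)
    also have "\<dots> = ennpow 2 e * (\<integral>\<^sup>+x. T x \<partial>lebesgue)"
      unfolding T_def by (rule nn_integral_cmult) measurable
    also have "(\<integral>\<^sup>+x. T x \<partial>lebesgue) = (\<Sum>k. \<integral>\<^sup>+x. ennpow (ennreal (d k) * Mk k x) e \<partial>lebesgue)"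
      unfolding T_def by (rule nn_integral_suminf) measurable
    also have "\<dots> \<le> (\<Sum>k. ennreal ((1/2) ^ k) * I)"
    proof (intro suminf_le summableI)
      fix k
      have "(\<integral>\<^sup>+x. ennpow (ennreal (d k) * Mk k x) e \<partial>lebesgue)
          = (\<integral>\<^sup>+x. ennreal (d k powr e) * ennpow (Mk k x) e \<partial>lebesgue)"
        using e d(1)[of k] by (simp add: ennpow_mult ennpow_ennreal)
      also have "\<dots> = ennreal (d k powr e) * (\<integral>\<^sup>+x. ennpow (Mk k x) e \<partial>lebesgue)"
        by (rule nn_integral_cmult) measurable
      also have "\<dots> \<le> ennreal (d k) * (ennreal (A ^ k) * I)"
      proof (intro mult_mono Mk_int ennreal_leI)
        show "d k powr e \<le> d k"
          using powr_mono'[of 1 e "d k"] e d[of k] by simp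
      qed auto
      also have "\<dots> = ennreal ((1/2) ^ k) * I"
        using d[of k] A by (simp flip: mult.assoc ennreal_mult)
      finally show "(\<integral>\<^sup>+x. ennpow (ennreal (d k) * Mk k x) e \<partial>lebesgue) \<le> ennreal ((1/2) ^ k) * I" .
    qed
    also have "\<dots> = 2 * I"
      by (simp only: ennreal_suminf_multc ennreal_suminf_half)
    finally have "(\<integral>\<^sup>+x. ennpow (\<Phi> x) e \<partial>lebesgue) \<le> ennpow 2 e * (2 * I)"
      by (simp add: mult_left_mono)
    also have "\<dots> < \<infinity>"
      using fin by (simp add: I_def ennpow_def ennreal_mult_less_top)
    finally show ?thesis .
  qed
  have avg: "(\<integral>\<^sup>+z\<in>ball y r. \<Phi> z \<partial>lebesgue) \<le> ennreal (4 * A) * emeasure lebesgue (ball y r) * \<Phi> x"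
    if x: "x \<in> ball y r" for x y r
  proof -
    have [measurable]: "ball y r \<in> sets lebesgue" by simp
    let ?v = "emeasure lebesgue (ball y r)"
    let ?c = "\<lambda>k. ennreal ((1/2) ^ k) * ennreal (d k)"
    have "(\<integral>\<^sup>+z\<in>ball y r. \<Phi> z \<partial>lebesgue)
        = (\<integral>\<^sup>+z. (\<Sum>k. ?c k * (Mk k z * indicator (ball y r) z)) \<partial>lebesgue)"
      unfolding \<Phi>_def by (simp only: ennreal_suminf_multc[symmetric] mult.assoc)
    also have "\<dots> = (\<Sum>k. \<integral>\<^sup>+z. ?c k * (Mk k z * indicator (ball y r) z) \<partial>lebesgue)"
      by (rule nn_integral_suminf) measurable
    also have "\<dots> \<le> (\<Sum>k. ennreal (4 * A) * ?v * (?c (Suc k) * Mk (Suc k) x))"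
    proof (intro suminf_le summableI)
      fix k
      have ck: "?c k = ennreal (4 * A) * ?c (Suc k)"
      proof -
        have "(1/2) ^ k * d k = (4 * A) * ((1/2) ^ Suc k * d (Suc k))"
          using A by (simp add: d_def)
        then show ?thesis
          using A d(1) by (simp add: less_imp_le flip: ennreal_mult)
      qed
      have "(\<integral>\<^sup>+z. ?c k * (Mk k z * indicator (ball y r) z) \<partial>lebesgue)
          = ?c k * (\<integral>\<^sup>+z. Mk k z * indicator (ball y r) z \<partial>lebesgue)"
        by (rule nn_integral_cmult) measurable
      also have "\<dots> \<le> ?c k * (Mk (Suc k) x * ?v)"
        using hl_maximal_ge[OF x, of "Mk k"] by (intro mult_left_mono) (auto simp: Mk_def)
      also have "\<dots> = ennreal (4 * A) * ?v * (?c (Suc k) * Mk (Suc k) x)"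
        unfolding ck by (simp only: ac_simps)
      finally show "(\<integral>\<^sup>+z. ?c k * (Mk k z * indicator (ball y r) z) \<partial>lebesgue)
          \<le> ennreal (4 * A) * ?v * (?c (Suc k) * Mk (Suc k) x)" .
    qed
    also have "\<dots> = ennreal (4 * A) * ?v * (\<Sum>k. ?c (Suc k) * Mk (Suc k) x)"
      by (rule ennreal_suminf_cmult)
    also have "\<dots> \<le> ennreal (4 * A) * ?v * \<Phi> x"
      using ennreal_suminf_Suc_le[of "\<lambda>k. ?c k * Mk k x"]
      by (intro mult_left_mono) (auto simp: \<Phi>_def mult.assoc)
    finally show ?thesis .
  qed
  show ?thesis
    by (rule that[OF \<Phi>_meas lower int _ avg]) (use A in auto)
qed

lemma cube_subset_ball:
  fixes a x :: "real ^ 'n"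
  assumes x: "x \<in> cbox a (\<chi> i. a $ i + l)" and l: "0 < l"
  shows "cbox a (\<chi> i. a $ i + l) \<subseteq> ball x ((real CARD('n) + 1) * l)"
proof
  fix y assume y: "y \<in> cbox a (\<chi> i. a $ i + l)"
  have "norm (x - y) \<le> (\<Sum>i\<in>UNIV. \<bar>(x - y) $ i\<bar>)"
    by (rule norm_le_l1_cart)
  also have "\<dots> \<le> (\<Sum>i\<in>(UNIV :: 'n set). l)"
  proof (rule sum_mono)
    fix i
    have "a $ i \<le> x $ i" "x $ i \<le> a $ i + l" "a $ i \<le> y $ i" "y $ i \<le> a $ i + l"
      using x y by (auto simp: mem_box_cart)
    then show "\<bar>(x - y) $ i\<bar> \<le> l" by simp
  qed
  also have "\<dots> < (real CARD('n) + 1) * l"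
    using l by (simp add: algebra_simps)
  finally show "y \<in> ball x ((real CARD('n) + 1) * l)"
    by (simp add: dist_norm)
qed

text \<open>
  The Muckenhoupt condition \<open>A\<^sub>1\<close> with the mean multiplied out by the volume \<open>l\<^sup>n\<close>. The null set may depend on the cube,
  which suffices for averages over that cube.
\<close>

definition A1_bound :: "real \<Rightarrow> (real ^ 'n \<Rightarrow> real) \<Rightarrow> bool" where
  "A1_bound C u \<longleftrightarrow> (\<forall>a l. 0 < l \<longrightarrow> (AE x in lebesgue. x \<in> cbox a (\<chi> i. a $ i + l) \<longrightarrow>
     (\<integral>\<^sup>+z\<in>cbox a (\<chi> i. a $ i + l). ennreal (u z) \<partial>lebesgue) \<le> ennreal (C * l ^ CARD('n) * u x)))"

lemma A1_boundD:
  fixes u :: "real ^ 'n \<Rightarrow> real"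
  assumes "A1_bound C u" "0 < l"
  shows "AE x in lebesgue. x \<in> cbox a (\<chi> i. a $ i + l) \<longrightarrow>
    (\<integral>\<^sup>+z\<in>cbox a (\<chi> i. a $ i + l). ennreal (u z) \<partial>lebesgue) \<le> ennreal (C * l ^ CARD('n) * u x)"
  using assms by (simp add: A1_bound_def)

text \<open>
  Apply the iteration to \<open>H\<^sup>\<gamma>\<close>, which lies in \<open>L\<close> with exponent \<open>1 / \<gamma>\<close>, and pass from balls to cubes. Raising \<open>H\<close> to at
  least \<open>1\<close> on the unit ball yields the last bound: the ball of radius \<open>1 + |x|\<close> about \<open>x\<close> contains the unit ball, so
  its mean, and hence \<open>Z x\<close>, cannot be much smaller than \<open>(1 + |x|)\<^sup>-\<^sup>n\<close>. The function is made finite and positive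
  everywhere by changing it on a null set.
\<close>

lemma A1_majorant:
  fixes H :: "real ^ 'n \<Rightarrow> ennreal"
  assumes [measurable]: "H \<in> borel_measurable lebesgue" and \<gamma>: "0 < \<gamma>" "\<gamma> < 1"
    and fin: "(\<integral>\<^sup>+x. H x \<partial>lebesgue) < \<infinity>"
  obtains Z :: "real ^ 'n \<Rightarrow> real" and C c where "Z \<in> borel_measurable lebesgue" "\<And>x. 0 < Z x"
    "AE x in lebesgue. H x \<le> ennreal (Z x powr (1 / \<gamma>))"
    "(\<integral>\<^sup>+x. ennreal (Z x powr (1 / \<gamma>)) \<partial>lebesgue) < \<infinity>"
    "1 \<le> C" "A1_bound C Z"
    "0 < c" "c \<le> 1" "\<And>x. c / (1 + norm x) ^ CARD('n) \<le> Z x"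
proof -
  let ?n = "CARD('n)"
  define \<psi> where "\<psi> x = ennpow (max (H x) (indicator (ball 0 1) x)) \<gamma>" for x :: "real ^ 'n"
  have [measurable]: "ball 0 1 \<in> sets (lebesgue :: (real ^ 'n) measure)" by simp
  have \<psi>_meas [measurable]: "\<psi> \<in> borel_measurable lebesgue"
    unfolding \<psi>_def by measurable
  have \<psi>_pow: "ennpow (\<psi> x) (1 / \<gamma>) = max (H x) (indicator (ball 0 1) x)" for x
    using \<gamma> by (simp add: \<psi>_def ennpow_ennpow)
  have "(\<integral>\<^sup>+x. ennpow (\<psi> x) (1 / \<gamma>) \<partial>lebesgue) \<le> (\<integral>\<^sup>+x. H x + indicator (ball 0 1) x \<partial>lebesgue)"
    unfolding \<psi>_pow by (intro nn_integral_mono) (auto simp: indicator_def)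
  also have "\<dots> = (\<integral>\<^sup>+x. H x \<partial>lebesgue) + emeasure lebesgue (ball (0 :: real ^ 'n) 1)"
    by (subst nn_integral_add) auto
  also have "\<dots> < \<infinity>"
    using fin by (simp add: emeasure_lebesgue_ball del: emeasure_completion)
  finally have \<psi>_fin: "(\<integral>\<^sup>+x. ennpow (\<psi> x) (1 / \<gamma>) \<partial>lebesgue) < \<infinity>" .
  obtain \<Phi> B where \<Phi>_meas [measurable]: "\<Phi> \<in> borel_measurable lebesgue" and lower: "\<And>x. \<psi> x \<le> \<Phi> x"
    and \<Phi>_fin: "(\<integral>\<^sup>+x. ennpow (\<Phi> x) (1 / \<gamma>) \<partial>lebesgue) < \<infinity>" and B: "1 \<le> B"
    and avg: "\<And>x y r. x \<in> ball y r \<Longrightarrow>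
       (\<integral>\<^sup>+z\<in>ball y r. \<Phi> z \<partial>lebesgue) \<le> ennreal B * emeasure lebesgue (ball y r) * \<Phi> x"
    using rubio_de_francia[OF \<psi>_meas _ \<psi>_fin] \<gamma> by (auto simp: field_simps)
  define Z where "Z x = (if \<Phi> x = \<infinity> then 1 else enn2real (\<Phi> x))" for x
  have [measurable]: "Z \<in> borel_measurable lebesgue"
    unfolding Z_def by measurable
  have "AE x in lebesgue. ennpow (\<Phi> x) (1 / \<gamma>) \<noteq> \<infinity>"
    using \<Phi>_fin by (intro nn_integral_PInf_AE) auto
  then have AE_Z: "AE x in lebesgue. \<Phi> x = ennreal (Z x)"
    by eventually_elim (auto simp: Z_def ennpow_def less_top split: if_splits)
  define \<omega> where "\<omega> = unit_ball_vol (real ?n)"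
  have \<omega>: "0 < \<omega>" by (simp add: \<omega>_def unit_ball_vol_pos)
  have ball_vol: "0 \<le> r \<Longrightarrow> emeasure lebesgue (ball (y :: real ^ 'n) r) = ennreal (\<omega> * r ^ ?n)" for y r
    by (simp add: emeasure_lebesgue_ball \<omega>_def del: emeasure_completion)
  have low: "(1 / B) / (1 + norm x) ^ ?n \<le> Z x" for x
  proof (cases "\<Phi> x = \<infinity>")
    case True
    have "1 \<le> B * (1 + norm x) ^ ?n"
      using B mult_mono[of 1 B 1 "(1 + norm x) ^ ?n"] by (simp add: one_le_power)
    then show ?thesis using True B by (simp add: Z_def divide_simps)
  next
    case False
    have sub: "ball 0 1 \<subseteq> ball x (1 + norm x)"
      by (auto simp: dist_norm) (smt (verit) norm_triangle_ineq4)
    have "ennreal \<omega> = (\<integral>\<^sup>+z\<in>ball 0 1. 1 \<partial>(lebesgue :: (real ^ 'n) measure))"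
      using ball_vol[of 1 0] by (simp del: emeasure_completion)
    also have "\<dots> \<le> (\<integral>\<^sup>+z\<in>ball x (1 + norm x). \<Phi> z \<partial>lebesgue)"
    proof (rule nn_integral_mono)
      fix z
      show "1 * indicator (ball 0 1) z \<le> \<Phi> z * indicator (ball x (1 + norm x)) z"
      proof (cases "z \<in> ball 0 1")
        case True
        have "1 = ennpow 1 \<gamma>" by (simp add: ennpow_def)
        also have "\<dots> \<le> \<psi> z"
          unfolding \<psi>_def using True \<gamma> by (intro ennpow_mono) auto
        finally show ?thesis
          using True sub lower[of z] by (auto simp: indicator_def)
      qed simp
    qed
    also have "\<dots> \<le> ennreal B * ennreal (\<omega> * (1 + norm x) ^ ?n) * \<Phi> x"
    proof -
      have "0 < 1 + norm x" by (simp add: add_pos_nonneg)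
      then show ?thesis using avg[of x x "1 + norm x"] by (simp add: ball_vol del: emeasure_completion)
    qed
    also have "\<Phi> x = ennreal (Z x)"
      using False by (simp add: Z_def less_top)
    finally have "\<omega> \<le> B * (\<omega> * (1 + norm x) ^ ?n) * Z x"
      using B \<omega> by (simp add: Z_def flip: ennreal_mult)
    then have "\<omega> * 1 \<le> \<omega> * (B * (1 + norm x) ^ ?n * Z x)" by (simp add: ac_simps)
    then have "1 \<le> B * (1 + norm x) ^ ?n * Z x"
      using \<omega> by (subst (asm) mult_le_cancel_left_pos) auto
    then show ?thesis using B by (simp add: divide_simps ac_simps add_pos_nonneg)
  qed
  have Z_pos: "0 < Z x" for x
    using low[of x] B by (smt (verit) divide_pos_pos norm_ge_zero zero_less_power)
  have major: "AE x in lebesgue. H x \<le> ennreal (Z x powr (1 / \<gamma>))"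
    using AE_Z
  proof eventually_elim
    fix x assume "\<Phi> x = ennreal (Z x)"
    then have "ennreal (Z x powr (1 / \<gamma>)) = ennpow (\<Phi> x) (1 / \<gamma>)"
      using Z_pos[of x] by (simp add: ennpow_ennreal)
    moreover have "H x \<le> ennpow (\<psi> x) (1 / \<gamma>)" by (simp add: \<psi>_pow)
    moreover have "ennpow (\<psi> x) (1 / \<gamma>) \<le> ennpow (\<Phi> x) (1 / \<gamma>)"
      using \<gamma> lower by (intro ennpow_mono) auto
    ultimately show "H x \<le> ennreal (Z x powr (1 / \<gamma>))" by simp
  qed
  have Z_fin: "(\<integral>\<^sup>+x. ennreal (Z x powr (1 / \<gamma>)) \<partial>lebesgue) < \<infinity>"
  proof -
    have "(\<integral>\<^sup>+x. ennreal (Z x powr (1 / \<gamma>)) \<partial>lebesgue) = (\<integral>\<^sup>+x. ennpow (\<Phi> x) (1 / \<gamma>) \<partial>lebesgue)"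
    proof (rule nn_integral_cong_AE)
      show "AE x in lebesgue. ennreal (Z x powr (1 / \<gamma>)) = ennpow (\<Phi> x) (1 / \<gamma>)"
        using AE_Z by eventually_elim (simp add: ennpow_ennreal less_imp_le[OF Z_pos])
    qed
    then show ?thesis using \<Phi>_fin by simp
  qed
  define C where "C = max 1 (B * \<omega> * (real ?n + 1) ^ ?n)"
  have cubes: "AE x in lebesgue. x \<in> cbox a (\<chi> i. a $ i + l) \<longrightarrow>
      (\<integral>\<^sup>+z\<in>cbox a (\<chi> i. a $ i + l). ennreal (Z z) \<partial>lebesgue) \<le> ennreal (C * l ^ ?n * Z x)"
    if l: "0 < l" for a l
    using AE_Z
  proof eventually_elim
    fix x assume Zx: "\<Phi> x = ennreal (Z x)"
    show "x \<in> cbox a (\<chi> i. a $ i + l) \<longrightarrow>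
      (\<integral>\<^sup>+z\<in>cbox a (\<chi> i. a $ i + l). ennreal (Z z) \<partial>lebesgue) \<le> ennreal (C * l ^ ?n * Z x)"
    proof
      assume x: "x \<in> cbox a (\<chi> i. a $ i + l)"
      let ?r = "(real ?n + 1) * l"
      have r: "0 < ?r" using l by simp
      have "(\<integral>\<^sup>+z\<in>cbox a (\<chi> i. a $ i + l). ennreal (Z z) \<partial>lebesgue)
          = (\<integral>\<^sup>+z\<in>cbox a (\<chi> i. a $ i + l). \<Phi> z \<partial>lebesgue)"
      proof (rule nn_integral_cong_AE)
        show "AE z in lebesgue. ennreal (Z z) * indicator (cbox a (\<chi> i. a $ i + l)) z
            = \<Phi> z * indicator (cbox a (\<chi> i. a $ i + l)) z"
          using AE_Z by eventually_elim simp
      qed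
      also have "\<dots> \<le> (\<integral>\<^sup>+z\<in>ball x ?r. \<Phi> z \<partial>lebesgue)"
        using cube_subset_ball[OF x l] by (intro nn_integral_mono) (auto simp: indicator_def)
      also have "\<dots> \<le> ennreal B * ennreal (\<omega> * ?r ^ ?n) * ennreal (Z x)"
        using avg[of x x ?r] r by (simp add: ball_vol Zx del: emeasure_completion)
      also have "\<dots> = ennreal (B * (\<omega> * ?r ^ ?n) * Z x)"
        using B \<omega> r Z_pos[of x] by (simp add: ennreal_mult less_imp_le)
      also have "\<dots> \<le> ennreal (C * l ^ ?n * Z x)"
      proof (intro ennreal_leI mult_right_mono)
        have "B * (\<omega> * ?r ^ ?n) = (B * \<omega> * (real ?n + 1) ^ ?n) * l ^ ?n"
          by (simp add: power_mult_distrib)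
        also have "\<dots> \<le> C * l ^ ?n"
          using l by (intro mult_right_mono) (auto simp: C_def)
        finally show "B * (\<omega> * ?r ^ ?n) \<le> C * l ^ ?n" .
      qed (use Z_pos[of x] in auto)
      finally show "(\<integral>\<^sup>+z\<in>cbox a (\<chi> i. a $ i + l). ennreal (Z z) \<partial>lebesgue) \<le> ennreal (C * l ^ ?n * Z x)" .
    qed
  qed
  show ?thesis
  proof (rule that[OF _ Z_pos major Z_fin _ _ _ _ low])
    show "A1_bound C Z" using cubes by (simp add: A1_bound_def)
    show "1 \<le> C" by (simp add: C_def)
    show "0 < 1 / B" "1 / B \<le> 1" using B by auto
  qed auto
qed

section \<open>Reverse Hoelder majorants for variable exponents\<close>

lemma emeasure_cube:
  fixes a :: "real ^ 'n"
  assumes "0 < l"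
  shows "emeasure lebesgue (cbox a (\<chi> i. a $ i + l)) = ennreal (l ^ CARD('n))"
proof -
  have side: "((\<chi> i. a $ i + l) - a) \<bullet> b = l" if "b \<in> Basis" for b :: "real ^ 'n"
    using that by (auto simp: Basis_vec_def inner_axis)
  have "\<forall>b\<in>Basis. a \<bullet> b \<le> (\<chi> i. a $ i + l) \<bullet> b"
    using side assms by (force simp: inner_diff_left)
  then have "emeasure lborel (cbox a (\<chi> i. a $ i + l)) = ennreal (\<Prod>b\<in>Basis. ((\<chi> i. a $ i + l) - a) \<bullet> b)"
    by (subst emeasure_lborel_cbox_eq) simp
  also have "(\<Prod>b\<in>Basis. ((\<chi> i. a $ i + l) - a) \<bullet> b) = (\<Prod>b\<in>(Basis :: (real ^ 'n) set). l)"
    by (rule prod.cong) (auto simp: side)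
  finally show ?thesis by simp
qed

lemma average_cube:
  assumes "0 < l"
  shows "average (cbox a (\<chi> i. (a :: real ^ 'n) $ i + l)) h * ennreal (l ^ CARD('n))
    = (\<integral>\<^sup>+x\<in>cbox a (\<chi> i. a $ i + l). h x \<partial>lebesgue)"
  using assms
  by (simp add: average_def emeasure_cube ennreal_divide_times del: emeasure_completion)

text \<open>
  For almost every \<open>x\<close> in a cube the mean of \<open>u\<close> is at most \<open>K u x\<close>; take the power \<open>1 / s\<close> of this and average over \<open>x\<close>.
\<close>

lemma RH_bound_of_A1:
  fixes u :: "real ^ 'n \<Rightarrow> real"
  assumes [measurable]: "u \<in> borel_measurable lebesgue" and u: "\<And>x. 0 < u x" and s: "0 < s" and K: "0 < K"
    and A1: "A1_bound K u"
  shows "RH_bound s (\<lambda>x. ennreal (u x powr (1 / s))) (K powr (1 / s))"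
  unfolding RH_bound_def
proof (intro conjI ballI)
  fix Q :: "(real ^ 'n) set"
  assume "Q \<in> cubes"
  then obtain a l where Q: "Q = cbox a (\<chi> i. a $ i + l)" and l: "0 < l"
    by (auto simp: cubes_def)
  let ?v = "ennreal (l ^ CARD('n))"
  define A where "A = average Q (\<lambda>x. ennreal (u x))"
  have v: "0 < ?v" "?v < top" using l by auto
  have cancel: "X \<le> Y" if "X * ?v \<le> Y * ?v" for X Y
    using that v by (metis divide_right_mono_ennreal ennreal_mult_divide_eq less_top order_less_irrefl)
  have w_pow: "ennpow (ennreal (u x powr (1 / s))) s = ennreal (u x)" for x
    using s u[of x] by (simp add: ennpow_ennreal powr_powr)
  have pt: "AE x in lebesgue. x \<in> Q \<longrightarrow> ennpow A (1 / s) \<le> ennreal (K powr (1 / s)) * ennreal (u x powr (1 / s))"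
    using A1_boundD[OF A1 l, of a]
  proof eventually_elim
    fix x assume *: "x \<in> cbox a (\<chi> i. a $ i + l) \<longrightarrow>
      (\<integral>\<^sup>+z\<in>cbox a (\<chi> i. a $ i + l). ennreal (u z) \<partial>lebesgue) \<le> ennreal (K * l ^ CARD('n) * u x)"
    show "x \<in> Q \<longrightarrow> ennpow A (1 / s) \<le> ennreal (K powr (1 / s)) * ennreal (u x powr (1 / s))"
    proof
      assume "x \<in> Q"
      then have "A * ?v \<le> ennreal (K * l ^ CARD('n) * u x)"
        using * l by (simp add: A_def Q average_cube)
      also have "\<dots> = ennreal (K * u x) * ?v"
        using K u[of x] l by (simp add: ac_simps flip: ennreal_mult)
      finally have "A \<le> ennreal (K * u x)" by (rule cancel)
      then have "ennpow A (1 / s) \<le> ennpow (ennreal (K * u x)) (1 / s)"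
        using s by (intro ennpow_mono) auto
      also have "\<dots> = ennreal (K powr (1 / s)) * ennreal (u x powr (1 / s))"
        using K u[of x] by (simp add: ennpow_ennreal powr_mult flip: ennreal_mult)
      finally show "ennpow A (1 / s) \<le> ennreal (K powr (1 / s)) * ennreal (u x powr (1 / s))" .
    qed
  qed
  have [measurable]: "Q \<in> sets lebesgue" by (simp add: Q)
  have "ennpow A (1 / s) * ?v = (\<integral>\<^sup>+x\<in>Q. ennpow A (1 / s) \<partial>lebesgue)"
    using l by (simp add: Q emeasure_cube nn_integral_cmult_indicator del: emeasure_completion)
  also have "\<dots> \<le> (\<integral>\<^sup>+x. ennreal (K powr (1 / s)) * (ennreal (u x powr (1 / s)) * indicator Q x) \<partial>lebesgue)"
  proof (rule nn_integral_mono_AE)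
    show "AE x in lebesgue. ennpow A (1 / s) * indicator Q x
        \<le> ennreal (K powr (1 / s)) * (ennreal (u x powr (1 / s)) * indicator Q x)"
      using pt by eventually_elim (auto simp: indicator_def)
  qed
  also have "\<dots> = ennreal (K powr (1 / s)) * (\<integral>\<^sup>+x\<in>Q. ennreal (u x powr (1 / s)) \<partial>lebesgue)"
    by (rule nn_integral_cmult) measurable
  also have "\<dots> = ennreal (K powr (1 / s)) * average Q (\<lambda>x. ennreal (u x powr (1 / s))) * ?v"
    using l by (simp add: Q average_cube mult.assoc)
  finally show "ennpow (average Q (\<lambda>x. ennpow (ennreal (u x powr (1 / s))) s)) (1 / s)
      \<le> ennreal (K powr (1 / s)) * average Q (\<lambda>x. ennreal (u x powr (1 / s)))"
    unfolding w_pow A_def[symmetric] by (rule cancel)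
qed simp

lemma ennreal_linear:
  "0 \<le> a \<Longrightarrow> 0 \<le> b \<Longrightarrow> 0 \<le> c \<Longrightarrow> ennreal (a + b * c) = ennreal a + ennreal b * ennreal c"
  by (simp add: ennreal_mult)

text \<open>
  A substitute for Jensen's inequality: integrated over a cube on which \<open>z\<close> has mean \<open>m\<close>, it bounds the mean of
  \<open>z\<^sup>\<tau>\<close> by \<open>2 m\<^sup>\<tau>\<close>, and it can be applied with an exponent \<open>\<tau>\<close> that varies from point to point.
\<close>

lemma powr_le_linear:
  assumes "0 < z" "0 < m" "0 \<le> \<tau>" "\<tau> \<le> 1"
  shows "z powr \<tau> \<le> m powr \<tau> * (1 + z / (m :: real))"
proof -
  have "(z / m) powr \<tau> \<le> 1 + z / m"
  proof (cases "z / m \<le> 1")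
    case True
    then have "(z / m) powr \<tau> \<le> 1"
      using assms by (intro powr_le1) auto
    then show ?thesis using assms by (smt (verit) divide_pos_pos)
  next
    case False
    then have "(z / m) powr \<tau> \<le> (z / m) powr 1"
      using assms by (intro powr_mono) auto
    then show ?thesis using assms by simp
  qed
  then have "m powr \<tau> * (z / m) powr \<tau> \<le> m powr \<tau> * (1 + z / m)"
    by (intro mult_left_mono) auto
  then show ?thesis
    using assms by (simp add: powr_divide)
qed

lemma powr_div_ge:
  assumes "0 < m" "1 \<le> C" "0 \<le> \<tau>" "\<tau> \<le> 1" "m \<le> C * (z :: real)"
  shows "m powr \<tau> / C \<le> z powr \<tau>"
proof -
  have "m powr \<tau> \<le> (C * z) powr \<tau>"
    using assms by (intro powr_mono2) auto
  also have "\<dots> = C powr \<tau> * z powr \<tau>"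
    by (rule powr_mult)
  also have "\<dots> \<le> C * z powr \<tau>"
    using assms powr_mono[of \<tau> 1 C] by (intro mult_right_mono) auto
  finally show ?thesis using assms by (simp add: divide_simps ac_simps)
qed

text \<open>
  This is the local log-Hoelder condition in the form in which it is used: on a cube of side \<open>l\<close>, a mean \<open>m\<close> that is at most of
  order \<open>l\<^sup>-\<^sup>n\<close> gives comparable powers \<open>m\<^sup>\<sigma>\<close> at any two points, since \<open>ln m\<close> is at most of order \<open>- ln |x - y|\<close>. When the
  points are at distance at least \<open>1 / 2\<close>, the side is bounded below and \<open>m\<close> itself is bounded.
\<close>

lemma log_hoelder_local_oscillation:
  fixes \<sigma> :: "'a::real_normed_vector \<Rightarrow> real"
  assumes \<sigma>: "\<And>x. 0 < \<sigma> x" "\<And>x. \<sigma> x \<le> 1" and c0: "0 \<le> c0"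
    and LH: "\<And>x y. x \<noteq> y \<Longrightarrow> norm (x - y) < 1 / 2 \<Longrightarrow> \<bar>\<sigma> x - \<sigma> y\<bar> \<le> c0 / (- ln (norm (x - y)))"
    and I: "0 \<le> I" and N: "0 < N" and l: "0 < l" and dist: "norm (x - y) \<le> N * l"
    and m: "1 \<le> m" "m \<le> 1 + I / l ^ n"
  shows "m powr (\<sigma> y - \<sigma> x) \<le> max (1 + I * (2 * N) ^ n) (exp (c0 * (ln (1 + I * (2 * N) ^ n) / ln 2 + real n)))"
proof -
  define P where "P = 1 + I * (2 * N) ^ n"
  have P: "1 \<le> P" using I N by (simp add: P_def)
  define d where "d = norm (x - y)"
  consider "x = y" | "x \<noteq> y" "d < 1 / 2" | "1 / 2 \<le> d" by linarith
  then show ?thesis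
  proof cases
    case 1
    then have "m powr (\<sigma> y - \<sigma> x) = 1" using m by simp
    also have "1 \<le> max (1 + I * (2 * N) ^ n) (exp (c0 * (ln (1 + I * (2 * N) ^ n) / ln 2 + real n)))"
      using P unfolding P_def by (rule max.coboundedI1)
    finally show ?thesis .
  next
    case 2
    then have d: "0 < d" by (simp add: d_def)
    have "I / l ^ n \<le> I * (N / d) ^ n"
    proof -
      have "1 / l \<le> N / d" using dist d l N by (simp add: d_def[symmetric] field_simps)
      then have "(1 / l) ^ n \<le> (N / d) ^ n" using l by (intro power_mono) auto
      then show ?thesis using I mult_left_mono[of "(1 / l) ^ n" "(N / d) ^ n" I] by (simp add: power_divide)
    qed
    also have "\<dots> \<le> I * (2 * N) ^ n / d ^ n"
      using I N d by (simp add: power_divide divide_right_mono mult_left_mono power_mono)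
    finally have "m \<le> 1 + I * (2 * N) ^ n / d ^ n" using m by linarith
    also have "\<dots> \<le> P / d ^ n"
    proof -
      have "d ^ n \<le> 1" using d 2 by (intro power_le_one) auto
      then have "1 \<le> 1 / d ^ n" using d by simp
      then show ?thesis by (simp add: P_def add_divide_distrib)
    qed
    finally have "ln m \<le> ln (P / d ^ n)" using m by simp
    also have "\<dots> = ln P + real n * (- ln d)"
      using P d by (simp add: ln_div ln_realpow)
    finally have lnm: "ln m \<le> ln P + real n * (- ln d)" .
    have lnd: "ln 2 \<le> - ln d"
    proof -
      have "ln 2 \<le> ln (1 / d)" using d 2 by (subst ln_le_cancel_iff) (auto simp: field_simps)
      then show ?thesis using d by (simp add: ln_div)
    qed
    have lnd_pos: "0 < - ln d" using lnd ln_gt_zero[of "2 :: real"] by linarith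
    have "(\<sigma> y - \<sigma> x) * ln m \<le> c0 / (- ln d) * ln m"
      using LH[OF 2(1)] 2(2) m by (intro mult_right_mono) (auto simp: d_def[symmetric])
    also have "\<dots> \<le> c0 / (- ln d) * (ln P + real n * (- ln d))"
      using lnm by (intro mult_left_mono divide_nonneg_nonneg c0) (use lnd_pos in auto)
    also have "\<dots> = c0 * (ln P / (- ln d) + real n)"
      using lnd_pos by (simp add: field_simps)
    also have "\<dots> \<le> c0 * (ln P / ln 2 + real n)"
      using lnd P c0 by (intro mult_left_mono add_right_mono frac_le) auto
    finally have "m powr (\<sigma> y - \<sigma> x) \<le> exp (c0 * (ln P / ln 2 + real n))"
      using m by (simp add: powr_def)
    then show ?thesis by (simp add: P_def)
  next
    case 3
    have "I / l ^ n \<le> I * (2 * N) ^ n"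
    proof -
      have "1 / l \<le> 2 * N" using dist 3 l by (simp add: d_def[symmetric] field_simps)
      then have "(1 / l) ^ n \<le> (2 * N) ^ n" using l by (intro power_mono) auto
      then show ?thesis using I mult_left_mono[of "(1 / l) ^ n" "(2 * N) ^ n" I] by (simp add: power_divide)
    qed
    then have "m \<le> P" using m by (simp add: P_def)
    moreover have "m powr (\<sigma> y - \<sigma> x) \<le> m powr 1"
      using m \<sigma>(1)[of x] \<sigma>(2)[of y] by (intro powr_mono) auto
    ultimately show ?thesis using m by (simp add: P_def)
  qed
qed

text \<open>
  Let \<open>m\<close> be the mean of \<open>Z\<close> over a cube \<open>Q\<close>; then \<open>Z \<ge> m / C\<close> almost everywhere in \<open>Q\<close>. If \<open>m > 1\<close>, integrability of
  \<open>Z\<close> to the power \<open>1 / \<gamma>\<close> bounds \<open>m\<close> by \<open>1 + I / |Q|\<close>, so all powers \<open>m\<^sup>\<sigma>\<close> taken on \<open>Q\<close> are comparable and \<open>u\<close>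
  behaves like a fixed power of \<open>Z\<close>. If \<open>m \<le> 1\<close>, the mean of \<open>u\<close> is at most of the order of \<open>m\<^sup>\<sigma>\<close> with
  \<open>\<sigma> = \<sigma>inf\<close>: where \<open>Z \<ge> 1\<close> the variable power is below \<open>Z\<close>, whose mean is \<open>m\<close>, and \<open>u\<close> is never much smaller than
  that. Using the constant exponent where \<open>Z < 1\<close> is what makes the second case work on cubes of every size and
  position.
\<close>

lemma A1_variable_power:
  fixes Z \<sigma> :: "real ^ 'n \<Rightarrow> real"
  assumes Zm [measurable]: "Z \<in> borel_measurable lebesgue" and Z: "\<And>x. 0 < Z x"
    and \<gamma>: "0 < \<gamma>" "\<gamma> < 1"
    and fin: "(\<integral>\<^sup>+x. ennreal (Z x powr (1 / \<gamma>)) \<partial>lebesgue) < \<infinity>"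
    and C: "1 \<le> C"
    and A1: "A1_bound C Z"
    and \<sigma>m [measurable]: "\<sigma> \<in> borel_measurable lebesgue"
    and \<sigma>: "\<And>x. 0 < \<sigma> x" "\<And>x. \<sigma> x \<le> 1" and \<sigma>inf: "0 \<le> \<sigma>inf" "\<sigma>inf \<le> 1"
    and c0: "0 \<le> c0"
    and LH: "\<And>x y. x \<noteq> y \<Longrightarrow> norm (x - y) < 1 / 2 \<Longrightarrow> \<bar>\<sigma> x - \<sigma> y\<bar> \<le> c0 / (- ln (norm (x - y)))"
  defines "u \<equiv> \<lambda>x. if 1 \<le> Z x then Z x powr \<sigma> x else Z x powr \<sigma>inf"
  shows "\<exists>K\<ge>1. A1_bound K u"
proof -
  let ?n = "CARD('n)"
  let ?N = "real ?n + 1"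
  obtain I where I: "0 \<le> I" "(\<integral>\<^sup>+x. ennreal (Z x powr (1 / \<gamma>)) \<partial>lebesgue) = ennreal I"
    using fin by (cases "\<integral>\<^sup>+x. ennreal (Z x powr (1 / \<gamma>)) \<partial>lebesgue") auto
  define D where "D = max (1 + I * (2 * ?N) ^ ?n) (exp (c0 * (ln (1 + I * (2 * ?N) ^ ?n) / ln 2 + real ?n)))"
  have D: "1 \<le> D"
    unfolding D_def using I by (intro max.coboundedI1) auto
  have "AE x in lebesgue. x \<in> cbox a (\<chi> i. a $ i + l) \<longrightarrow>
      (\<integral>\<^sup>+z\<in>cbox a (\<chi> i. a $ i + l). ennreal (u z) \<partial>lebesgue) \<le> ennreal (3 * C * D * l ^ ?n * u x)"
    if l: "0 < l" for a l
  proof -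
    define Q where "Q = cbox a (\<chi> i. a $ i + l)"
    have [measurable]: "Q \<in> sets lebesgue" by (simp add: Q_def)
    have Q_vol: "emeasure lebesgue Q = ennreal (l ^ ?n)"
      using emeasure_cube[OF l, of a] by (simp add: Q_def)
    have ln: "0 < l ^ ?n" using l by simp
    have "(\<integral>\<^sup>+z\<in>Q. ennreal (Z z) \<partial>lebesgue) \<le> (\<integral>\<^sup>+z. indicator Q z + ennreal (Z z powr (1 / \<gamma>)) \<partial>lebesgue)"
    proof (rule nn_integral_mono)
      fix z
      have "Z z \<le> 1 + Z z powr (1 / \<gamma>)"
        using powr_mono[of 1 "1 / \<gamma>" "Z z"] Z[of z] \<gamma> by (cases "1 \<le> Z z") (auto simp: add_increasing2)
      then have "ennreal (Z z) \<le> 1 + ennreal (Z z powr (1 / \<gamma>))"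
        by (simp flip: ennreal_1 ennreal_plus)
      then show "ennreal (Z z) * indicator Q z \<le> indicator Q z + ennreal (Z z powr (1 / \<gamma>))"
        by (auto simp: indicator_def)
    qed
    also have "\<dots> = ennreal (l ^ ?n + I)"
      using ln I by (subst nn_integral_add) (auto simp: Q_vol simp del: emeasure_completion)
    finally have J_le: "(\<integral>\<^sup>+z\<in>Q. ennreal (Z z) \<partial>lebesgue) \<le> ennreal (l ^ ?n + I)" .
    then obtain J where J: "0 \<le> J" "(\<integral>\<^sup>+z\<in>Q. ennreal (Z z) \<partial>lebesgue) = ennreal J"
      by (cases "\<integral>\<^sup>+z\<in>Q. ennreal (Z z) \<partial>lebesgue") (auto simp: top_unique)
    show ?thesis
    proof (cases "J = 0")
      case True
      then have "(\<integral>\<^sup>+z\<in>Q. ennreal (Z z) \<partial>lebesgue) = 0" using J by simp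
      then have "AE x in lebesgue. ennreal (Z x) * indicator Q x = 0"
        by (subst (asm) nn_integral_0_iff_AE) auto
      then show ?thesis
        unfolding Q_def[symmetric]
      proof eventually_elim
        fix x assume "ennreal (Z x) * indicator Q x = 0"
        then have "x \<notin> Q" using Z[of x] by (auto simp: indicator_def ennreal_eq_0_iff)
        then show "x \<in> Q \<longrightarrow> (\<integral>\<^sup>+z\<in>Q. ennreal (u z) \<partial>lebesgue) \<le> ennreal (3 * C * D * l ^ ?n * u x)"
          by simp
      qed
    next
      case False
      define m where "m = J / l ^ ?n"
      have m: "0 < m" using False J(1) ln by (simp add: m_def)
      have J_m: "J = m * l ^ ?n" using l by (simp add: m_def)
      have m_le: "m \<le> 1 + I / l ^ ?n"
      proof -
        have "J \<le> l ^ ?n + I" using J_le J I ln by (simp del: ennreal_plus)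
        then have "J / l ^ ?n \<le> (l ^ ?n + I) / l ^ ?n" using ln by (intro divide_right_mono) auto
        then show ?thesis using l by (simp add: m_def add_divide_distrib)
      qed
      \<comment> \<open>the two cases below use this with \<open>k = 1\<close> and \<open>k = 2\<close>: as \<open>Z\<close> has mean \<open>m\<close>, the bracket has mean \<open>3\<close>\<close>
      have integrate: "(\<integral>\<^sup>+z\<in>Q. ennreal (u z) \<partial>lebesgue) \<le> ennreal (3 * B * l ^ ?n)"
        if B: "0 \<le> B" and pt: "\<And>z. z \<in> Q \<Longrightarrow> u z \<le> B * (k + (3 - k) * (Z z / m))" and k: "0 \<le> k" "k \<le> 3" for B k
      proof -
        have "(\<integral>\<^sup>+z\<in>Q. ennreal (u z) \<partial>lebesgue)
            \<le> (\<integral>\<^sup>+z. ennreal (B * k) * indicator Q z + ennreal (B * (3 - k) / m) * (ennreal (Z z) * indicator Q z) \<partial>lebesgue)"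
        proof (rule nn_integral_mono)
          fix z
          have "ennreal (u z) \<le> ennreal (B * k) + ennreal (B * (3 - k) / m) * ennreal (Z z)" if "z \<in> Q"
          proof -
            have "ennreal (u z) \<le> ennreal (B * k + (B * (3 - k) / m) * Z z)"
              using pt[OF that] by (intro ennreal_leI) (simp add: distrib_left)
            then show ?thesis
              using B k m Z[of z] by (subst (asm) ennreal_linear) auto
          qed
          then show "ennreal (u z) * indicator Q z
            \<le> ennreal (B * k) * indicator Q z + ennreal (B * (3 - k) / m) * (ennreal (Z z) * indicator Q z)"
            by (auto simp: indicator_def)
        qed
        also have "\<dots> = ennreal (B * k) * ennreal (l ^ ?n) + ennreal (B * (3 - k) / m) * ennreal J"
          by (subst nn_integral_add) (auto simp: nn_integral_cmult nn_integral_cmult_indicator Q_vol J(2) simp del: emeasure_completion)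
        also have "\<dots> = ennreal (B * k * l ^ ?n + (B * (3 - k) / m) * J)"
          using B k m J(1) ln by (subst ennreal_linear) (auto simp: ennreal_mult)
        also have "B * k * l ^ ?n + (B * (3 - k) / m) * J = 3 * B * l ^ ?n"
          using m by (simp add: J_m field_simps)
        finally show ?thesis .
      qed
      show ?thesis
        using A1_boundD[OF A1 l, of a] unfolding Q_def[symmetric]
      proof (eventually_elim, intro impI)
        fix x assume *: "x \<in> Q \<longrightarrow> (\<integral>\<^sup>+z\<in>Q. ennreal (Z z) \<partial>lebesgue) \<le> ennreal (C * l ^ ?n * Z x)"
          and x: "x \<in> Q"
        have "J \<le> C * l ^ ?n * Z x"
          using * x J C ln Z[of x] by simp
        then have mC: "m \<le> C * Z x"
          using ln by (simp add: m_def field_simps)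
        show "(\<integral>\<^sup>+z\<in>Q. ennreal (u z) \<partial>lebesgue) \<le> ennreal (3 * C * D * l ^ ?n * u x)"
        proof (cases "m \<le> 1")
          case True
          have mm: "m \<le> m powr \<sigma>inf" "m powr \<sigma>inf \<le> 1"
            using powr_mono'[of \<sigma>inf 1 m] \<sigma>inf m True by (auto intro!: powr_le1)
          have "(\<integral>\<^sup>+z\<in>Q. ennreal (u z) \<partial>lebesgue) \<le> ennreal (3 * m powr \<sigma>inf * l ^ ?n)"
          proof (rule integrate[where k = 1])
            fix z
            have lin: "Z z \<le> m powr \<sigma>inf * (Z z / m)"
              using mult_right_mono[OF mm(1), of "Z z / m"] m Z[of z] by simp
            have "u z \<le> Z z + Z z powr \<sigma>inf"
              using powr_mono[of "\<sigma> z" 1 "Z z"] \<sigma>(2)[of z] Z[of z] by (auto simp: u_def add_increasing2)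
            also have "\<dots> \<le> m powr \<sigma>inf * (Z z / m) + m powr \<sigma>inf * (1 + Z z / m)"
              using lin powr_le_linear[OF Z m \<sigma>inf, of z] by linarith
            finally show "u z \<le> m powr \<sigma>inf * (1 + (3 - 1) * (Z z / m))"
              by (simp add: algebra_simps)
          qed auto
          also have "\<dots> \<le> ennreal (3 * C * D * l ^ ?n * u x)"
          proof (rule ennreal_leI)
            have "m powr \<sigma>inf / C \<le> u x"
            proof (cases "1 \<le> Z x")
              case True
              have "m powr \<sigma>inf / C \<le> 1" using mm C by (simp add: divide_simps)
              also have "1 \<le> u x" using True \<sigma>(1)[of x] by (simp add: u_def ge_one_powr_ge_zero)
              finally show ?thesis .
            next
              case False
              then show ?thesis using powr_div_ge[OF m C \<sigma>inf mC] by (simp add: u_def)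
            qed
            then have "m powr \<sigma>inf \<le> C * u x" using C by (simp add: field_simps)
            also have "\<dots> \<le> C * u x * D" using D C mult_left_mono[of 1 D "C * u x"] by (simp add: u_def)
            finally have "3 * l ^ ?n * m powr \<sigma>inf \<le> 3 * l ^ ?n * (C * u x * D)"
              using ln by (intro mult_left_mono) auto
            then show "3 * m powr \<sigma>inf * l ^ ?n \<le> 3 * C * D * l ^ ?n * u x"
              by (simp add: ac_simps)
          qed
          finally show ?thesis .
        next
          case False
          have "(\<integral>\<^sup>+z\<in>Q. ennreal (u z) \<partial>lebesgue) \<le> ennreal (3 * (D * m powr \<sigma> x) * l ^ ?n)"
          proof (rule integrate[where k = 2])
            fix z assume z: "z \<in> Q"
            have "norm (x - z) \<le> ?N * l"
              using cube_subset_ball[OF x[unfolded Q_def] l] z by (auto simp: Q_def dist_norm subset_iff)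
            then have "m powr (\<sigma> z - \<sigma> x) \<le> D"
              unfolding D_def using False m_le l I by (intro log_hoelder_local_oscillation[OF \<sigma> c0 LH]) auto
            then have osc: "m powr \<sigma> z \<le> D * m powr \<sigma> x"
              using m by (simp add: powr_diff field_simps)
            have ge1: "1 \<le> D * m powr \<sigma> x"
              using D False \<sigma>(1)[of x] mult_mono[of 1 D 1 "m powr \<sigma> x"] by (simp add: ge_one_powr_ge_zero)
            have "u z \<le> 1 + Z z powr \<sigma> z"
              using Z[of z] \<sigma>inf by (auto simp: u_def intro!: add_increasing2 powr_le1)
            also have "\<dots> \<le> 1 + m powr \<sigma> z * (1 + Z z / m)"
              using powr_le_linear[OF Z m, of "\<sigma> z" z] \<sigma>(1)[of z] \<sigma>(2)[of z] by simp
            also have "\<dots> \<le> D * m powr \<sigma> x + D * m powr \<sigma> x * (1 + Z z / m)"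
              using osc ge1 m Z[of z] by (intro add_mono mult_right_mono) auto
            finally show "u z \<le> D * m powr \<sigma> x * (2 + (3 - 2) * (Z z / m))"
              by (simp add: algebra_simps)
          qed (use D in auto)
          also have "\<dots> \<le> ennreal (3 * C * D * l ^ ?n * u x)"
          proof (rule ennreal_leI)
            have sx: "0 \<le> \<sigma> x" "\<sigma> x \<le> 1" using \<sigma>(1)[of x] \<sigma>(2)[of x] by auto
            have "m powr \<sigma> x / C \<le> u x"
            proof (cases "1 \<le> Z x")
              case True
              then show ?thesis using powr_div_ge[OF m C sx mC] by (simp add: u_def)
            next
              case Z1: False
              have "m powr \<sigma> x \<le> m powr 1" using False sx by (intro powr_mono) auto
              also have "\<dots> \<le> C * Z x" using mC m by simp
              also have "\<dots> \<le> C * Z x powr \<sigma>inf"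
                using powr_mono'[of \<sigma>inf 1 "Z x"] \<sigma>inf Z1 Z[of x] C by (intro mult_left_mono) auto
              finally show ?thesis using Z1 C by (simp add: u_def divide_simps ac_simps)
            qed
            then have "m powr \<sigma> x \<le> C * u x" using C by (simp add: field_simps)
            then have "3 * l ^ ?n * D * m powr \<sigma> x \<le> 3 * l ^ ?n * D * (C * u x)"
              using ln D by (intro mult_left_mono) auto
            then show "3 * (D * m powr \<sigma> x) * l ^ ?n \<le> 3 * C * D * l ^ ?n * u x"
              by (simp add: ac_simps)
          qed
          finally show ?thesis .
        qed
      qed
    qed
  qed
  moreover have "1 \<le> 3 * C * D"
    using C D mult_mono[of 1 C 1 D] by simp
  ultimately show ?thesis unfolding A1_bound_def by blast
qed

text \<open>
  Since \<open>z\<close> decays at most like \<open>R\<^sup>-\<^sup>n\<close>, its logarithm is of order \<open>ln (e + R)\<close> and cancels the denominator in the bound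
  for \<open>\<eta>\<close>. This is how the log-Hoelder condition at infinity is used.
\<close>

lemma log_hoelder_at_infinity:
  fixes z c E \<eta> R :: real
  assumes z: "0 < z" "z < 1" and c: "0 < c" "c \<le> 1" and R: "0 \<le> R" and low: "c / (1 + R) ^ n \<le> z"
    and E: "0 \<le> E" and \<eta>: "\<bar>\<eta>\<bar> \<le> E / ln (exp 1 + R)"
  shows "z powr \<eta> \<le> exp (E * (- ln c + real n))"
proof -
  let ?L = "ln (exp 1 + R)"
  have L: "1 \<le> ?L"
  proof -
    have "ln (exp 1) \<le> ?L" using R by (subst ln_le_cancel_iff) (auto simp: add_pos_nonneg)
    then show ?thesis by simp
  qed
  have "ln (c / (1 + R) ^ n) \<le> ln z"
    using z c R low by (subst ln_le_cancel_iff) auto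
  then have "- ln z \<le> - ln c + real n * ln (1 + R)"
    using c R by (simp add: ln_div ln_realpow)
  also have "\<dots> \<le> - ln c * ?L + real n * ?L"
  proof (rule add_mono)
    show "- ln c \<le> - ln c * ?L"
      using L c mult_left_mono[of 1 ?L "- ln c"] by simp
    have "1 + R \<le> exp 1 + R" using exp_ge_add_one_self[of 1] by simp
    then have "ln (1 + R) \<le> ?L"
      using R by (subst ln_le_cancel_iff) (auto simp: add_pos_nonneg)
    then show "real n * ln (1 + R) \<le> real n * ?L"
      by (intro mult_left_mono) auto
  qed
  finally have bound: "- ln z \<le> (- ln c + real n) * ?L" by (simp add: algebra_simps)
  have "\<eta> * ln z \<le> \<bar>\<eta>\<bar> * (- ln z)"
  proof -
    have "ln z < 0" using z by simp
    then show ?thesis using abs_ge_self[of "\<eta> * ln z"] by (simp add: abs_mult)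
  qed
  also have "\<dots> \<le> E / ?L * ((- ln c + real n) * ?L)"
    using \<eta> bound z E L by (intro mult_mono) auto
  also have "\<dots> = E * (- ln c + real n)"
    using L by simp
  finally show ?thesis using z by (simp add: powr_def)
qed

text \<open>
  Here \<open>1 / \<beta>\<close> is a variable exponent bounded away from \<open>s\<close> and \<open>\<infinity>\<close>. With \<open>\<gamma> = s b1 < 1\<close> and \<open>Z\<close> the \<open>A\<^sub>1\<close> majorant of
  \<open>H\<^sup>\<gamma>\<close>, the weight is \<open>w = u\<close> to the power \<open>1 / s\<close>, where \<open>u\<close> is the variable power of \<open>Z\<close> with \<open>\<sigma> = \<beta> / b1\<close>. As
  \<open>s \<beta> = \<gamma> \<sigma>\<close>, the power \<open>1 / \<beta>\<close> of \<open>w\<close> equals the power \<open>1 / \<gamma>\<close> of \<open>Z\<close> where \<open>Z \<ge> 1\<close>, and differs from it by a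
  bounded factor elsewhere because \<open>\<beta>\<close> has a limit at infinity at logarithmic rate.
\<close>

lemma reverse_hoelder_majorant:
  fixes \<beta> :: "real ^ 'n \<Rightarrow> real"
  assumes s: "1 < s" and \<beta>m [measurable]: "\<beta> \<in> borel_measurable lebesgue"
    and b: "0 < b0" "b1 < 1 / s" and \<beta>: "\<And>x. b0 \<le> \<beta> x" "\<And>x. \<beta> x \<le> b1" and LH: "\<beta> \<in> LH"
    and Hm: "H \<in> borel_measurable lebesgue" and fin: "(\<integral>\<^sup>+x. H x \<partial>lebesgue) < \<infinity>"
  obtains w :: "real ^ 'n \<Rightarrow> real" and D where "(\<lambda>x. ennreal (w x)) \<in> RH s" "w \<in> borel_measurable lebesgue" "\<And>x. 0 < w x"
    "1 \<le> D" "AE x in lebesgue. H x \<le> ennreal (D * w x powr (1 / \<beta> x))"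
    "(\<integral>\<^sup>+x. ennreal (w x powr (1 / \<beta> x)) \<partial>lebesgue) < \<infinity>"
proof -
  let ?n = "CARD('n)"
  have b01: "b0 \<le> b1" using \<beta>(1)[of 0] \<beta>(2)[of 0] by linarith
  have \<beta>_pos: "0 < \<beta> x" for x using \<beta>(1)[of x] b by linarith
  define \<gamma> where "\<gamma> = s * b1"
  have \<gamma>: "0 < \<gamma>" "\<gamma> < 1"
    using s b b01 by (auto simp: \<gamma>_def field_simps)
  obtain Z :: "real ^ 'n \<Rightarrow> real" and C c where Zm [measurable]: "Z \<in> borel_measurable lebesgue"
    and Z: "\<And>x. 0 < Z x" and major: "AE x in lebesgue. H x \<le> ennreal (Z x powr (1 / \<gamma>))"
    and Z_fin: "(\<integral>\<^sup>+x. ennreal (Z x powr (1 / \<gamma>)) \<partial>lebesgue) < \<infinity>" and C: "1 \<le> C"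
    and A1: "A1_bound C Z"
    and c: "0 < c" "c \<le> 1" and low: "\<And>x. c / (1 + norm x) ^ ?n \<le> Z x"
    using A1_majorant[OF Hm \<gamma> fin] by blast
  obtain c0' where c0': "\<And>x y. x \<noteq> y \<Longrightarrow> norm (x - y) < 1 / 2 \<Longrightarrow> \<bar>\<beta> x - \<beta> y\<bar> \<le> c0' / (- ln (norm (x - y)))"
    using LH by (auto simp: LH_def)
  obtain ci' binf' where ci': "\<And>x. \<bar>\<beta> x - binf'\<bar> \<le> ci' / ln (exp 1 + norm x)"
    using LH by (auto simp: LH_def)
  \<comment> \<open>clamping the limit to the range of \<open>\<beta>\<close> only brings it closer to the values of \<open>\<beta>\<close>\<close>
  define binf where "binf = max b0 (min b1 binf')"
  have binf: "b0 \<le> binf" "binf \<le> b1" using b01 by (auto simp: binf_def)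
  have L_pos: "0 < ln (exp 1 + norm x)" for x :: "real ^ 'n"
    by (rule ln_gt_zero) (smt (verit) exp_gt_one norm_ge_zero)
  define ci where "ci = max 0 ci'"
  have ci: "\<bar>\<beta> x - binf\<bar> \<le> ci / ln (exp 1 + norm x)" for x
  proof -
    have "\<bar>\<beta> x - binf\<bar> \<le> \<bar>\<beta> x - binf'\<bar>"
      using \<beta>(1)[of x] \<beta>(2)[of x] by (auto simp: binf_def max_def min_def)
    also have "\<dots> \<le> ci' / ln (exp 1 + norm x)" by (rule ci')
    also have "\<dots> \<le> ci / ln (exp 1 + norm x)"
      using L_pos[of x] by (intro divide_right_mono) (auto simp: ci_def)
    finally show ?thesis .
  qed
  define \<sigma> where "\<sigma> x = \<beta> x / b1" for x
  define \<sigma>inf where "\<sigma>inf = binf / b1"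
  have b1: "0 < b1" using b b01 by linarith
  have \<sigma>: "0 < \<sigma> x" "\<sigma> x \<le> 1" for x
    using \<beta>_pos[of x] \<beta>(2)[of x] b1 by (auto simp: \<sigma>_def)
  have \<sigma>inf: "0 \<le> \<sigma>inf" "\<sigma>inf \<le> 1" using binf b b1 by (auto simp: \<sigma>inf_def)
  have [measurable]: "\<sigma> \<in> borel_measurable lebesgue" unfolding \<sigma>_def by measurable
  define c0 where "c0 = max 0 c0' / b1"
  have c0: "0 \<le> c0" using b1 by (simp add: c0_def)
  have \<sigma>LH: "\<bar>\<sigma> x - \<sigma> y\<bar> \<le> c0 / (- ln (norm (x - y)))" if "x \<noteq> y" "norm (x - y) < 1 / 2" for x y
  proof -
    have "0 \<le> - ln (norm (x - y))" using that by (simp add: ln_le_zero_iff)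
    then have "\<bar>\<beta> x - \<beta> y\<bar> \<le> max 0 c0' / (- ln (norm (x - y)))"
      using c0'[OF that] divide_right_mono[of c0' "max 0 c0'" "- ln (norm (x - y))"] by simp
    then have "\<bar>\<beta> x - \<beta> y\<bar> / b1 \<le> max 0 c0' / (- ln (norm (x - y))) / b1"
      using b1 by (intro divide_right_mono) auto
    moreover have "\<bar>\<sigma> x - \<sigma> y\<bar> = \<bar>\<beta> x - \<beta> y\<bar> / b1"
      using b1 by (simp add: \<sigma>_def flip: diff_divide_distrib)
    ultimately show ?thesis by (simp add: c0_def mult.commute)
  qed
  define u where "u = (\<lambda>x. if 1 \<le> Z x then Z x powr \<sigma> x else Z x powr \<sigma>inf)"
  have [measurable]: "u \<in> borel_measurable lebesgue" unfolding u_def by measurable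
  have u: "0 < u x" for x using Z[of x] by (simp add: u_def)
  have "\<exists>K\<ge>1. A1_bound K u"
    unfolding u_def
    by (rule A1_variable_power[where \<gamma> = \<gamma> and C = C and ?c0.0 = c0]) fact+
  then obtain K where K: "1 \<le> K" and uA1: "A1_bound K u"
    by blast
  define w where "w x = u x powr (1 / s)" for x
  have [measurable]: "w \<in> borel_measurable lebesgue" unfolding w_def by measurable
  have w: "0 < w x" for x using u[of x] by (simp add: w_def)
  have RHb: "RH_bound s (\<lambda>x. ennreal (w x)) (K powr (1 / s))"
    unfolding w_def using s K by (intro RH_bound_of_A1 u uA1) auto
  define E where "E = ci / (\<gamma> * b0)"
  have E: "0 \<le> E" using \<gamma> b by (simp add: E_def ci_def)
  define D where "D = exp (E * (- ln c + real ?n))"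
  have D: "1 \<le> D"
  proof -
    have "0 \<le> E * (- ln c + real ?n)"
    proof (rule mult_nonneg_nonneg[OF E])
      have "ln c \<le> 0" using c by simp
      then show "0 \<le> - ln c + real ?n" by linarith
    qed
    then show ?thesis by (simp add: D_def)
  qed
  have w_pow: "w x powr (1 / \<beta> x) = u x powr (1 / (\<gamma> * \<sigma> x))" for x
    using b1 by (simp add: w_def powr_powr \<gamma>_def \<sigma>_def)
  have comparable: "Z x powr (1 / \<gamma>) \<le> D * w x powr (1 / \<beta> x) \<and> w x powr (1 / \<beta> x) \<le> D * Z x powr (1 / \<gamma>)" for x
  proof (cases "1 \<le> Z x")
    case True
    then have "w x powr (1 / \<beta> x) = Z x powr (1 / \<gamma>)"
      using \<sigma>(1)[of x] by (simp add: w_pow u_def powr_powr)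
    then show ?thesis using D mult_right_mono[of 1 D "Z x powr (1 / \<gamma>)"] by simp
  next
    case False
    \<comment> \<open>the deviation of the exponent \<open>\<sigma>inf / (\<gamma> \<sigma> x)\<close> from \<open>1 / \<gamma>\<close>\<close>
    define \<eta> where "\<eta> = (binf - \<beta> x) / (\<gamma> * \<beta> x)"
    have "\<bar>\<eta>\<bar> = \<bar>\<beta> x - binf\<bar> / (\<gamma> * \<beta> x)"
      using \<gamma> \<beta>_pos[of x] by (simp add: \<eta>_def abs_divide abs_mult abs_minus_commute)
    also have "\<dots> \<le> (ci / ln (exp 1 + norm x)) / (\<gamma> * b0)"
      using \<gamma> \<beta>(1)[of x] b ci[of x] L_pos[of x] by (intro frac_le mult_left_mono) (auto simp: ci_def)
    also have "\<dots> = E / ln (exp 1 + norm x)" by (simp add: E_def)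
    finally have \<eta>: "\<bar>\<eta>\<bar> \<le> E / ln (exp 1 + norm x)" .
    have bounds: "Z x powr \<eta> \<le> D" "Z x powr (- \<eta>) \<le> D"
      unfolding D_def using \<eta> False
      by (intro log_hoelder_at_infinity[OF Z _ c _ low[of x] E]; simp)+
    have "w x powr (1 / \<beta> x) = Z x powr (\<sigma>inf / (\<gamma> * \<sigma> x))"
      using False by (simp add: w_pow u_def powr_powr)
    also have "\<sigma>inf / (\<gamma> * \<sigma> x) = 1 / \<gamma> + \<eta>"
      using \<gamma> \<beta>_pos[of x] b1 by (simp add: \<sigma>inf_def \<sigma>_def \<eta>_def field_simps)
    finally have eq: "w x powr (1 / \<beta> x) = Z x powr (1 / \<gamma>) * Z x powr \<eta>"
      by (simp add: powr_add)
    then have eq': "Z x powr (1 / \<gamma>) = w x powr (1 / \<beta> x) * Z x powr (- \<eta>)"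
      using Z[of x] by (simp add: powr_minus field_simps)
    show ?thesis
      using mult_left_mono[OF bounds(1), of "Z x powr (1 / \<gamma>)"] mult_left_mono[OF bounds(2), of "w x powr (1 / \<beta> x)"]
      unfolding eq[symmetric] eq'[symmetric] by (simp add: mult.commute)
  qed
  have w_fin: "(\<integral>\<^sup>+x. ennreal (w x powr (1 / \<beta> x)) \<partial>lebesgue) < \<infinity>"
  proof -
    have "(\<integral>\<^sup>+x. ennreal (w x powr (1 / \<beta> x)) \<partial>lebesgue)
        \<le> (\<integral>\<^sup>+x. ennreal D * ennreal (Z x powr (1 / \<gamma>)) \<partial>lebesgue)"
      using comparable D by (intro nn_integral_mono) (simp flip: ennreal_mult)
    also have "\<dots> = ennreal D * (\<integral>\<^sup>+x. ennreal (Z x powr (1 / \<gamma>)) \<partial>lebesgue)"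
      by (rule nn_integral_cmult) measurable
    also have "\<dots> < \<infinity>" using Z_fin by (simp add: ennreal_mult_less_top)
    finally show ?thesis .
  qed
  have major': "AE x in lebesgue. H x \<le> ennreal (D * w x powr (1 / \<beta> x))"
    using major
  proof eventually_elim
    fix x assume "H x \<le> ennreal (Z x powr (1 / \<gamma>))"
    also have "\<dots> \<le> ennreal (D * w x powr (1 / \<beta> x))"
      using comparable[of x] by (intro ennreal_leI) simp
    finally show "H x \<le> ennreal (D * w x powr (1 / \<beta> x))" .
  qed
  have "weight (\<lambda>x. ennreal (w x))"
    unfolding weight_def
  proof (intro conjI allI impI)
    fix Q :: "(real ^ 'n) set" assume Q: "compact Q"
    then have Qm [measurable]: "Q \<in> sets lebesgue"
      by (simp add: borel_compact)
    have "(\<integral>\<^sup>+x\<in>Q. ennreal (w x) \<partial>lebesgue) \<le> (\<integral>\<^sup>+x. indicator Q x + ennreal (w x powr (1 / \<beta> x)) \<partial>lebesgue)"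
    proof (rule nn_integral_mono)
      fix x
      have "b1 < 1"
      proof -
        have "1 / s < 1" using s by simp
        then show ?thesis using b by linarith
      qed
      then have "1 \<le> 1 / \<beta> x" using \<beta>_pos[of x] \<beta>(2)[of x] by (simp add: divide_simps)
      then have "w x \<le> 1 + w x powr (1 / \<beta> x)"
        using powr_mono[of 1 "1 / \<beta> x" "w x"] w[of x] by (cases "1 \<le> w x") (auto simp: add_increasing2)
      then have "ennreal (w x) \<le> 1 + ennreal (w x powr (1 / \<beta> x))"
        by (simp flip: ennreal_1 ennreal_plus)
      then show "ennreal (w x) * indicator Q x \<le> indicator Q x + ennreal (w x powr (1 / \<beta> x))"
        by (auto simp: indicator_def)
    qed
    also have "\<dots> = emeasure lebesgue Q + (\<integral>\<^sup>+x. ennreal (w x powr (1 / \<beta> x)) \<partial>lebesgue)"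
      by (subst nn_integral_add) (auto simp del: emeasure_completion)
    also have "\<dots> < \<infinity>"
    proof -
      have "emeasure lebesgue Q < \<infinity>"
        using emeasure_bounded_finite[of Q] Q by (simp add: compact_imp_bounded borel_compact)
      then show ?thesis using w_fin by simp
    qed
    finally show "(\<integral>\<^sup>+x\<in>Q. ennreal (w x) \<partial>lebesgue) < \<infinity>" .
  qed (use w in auto)
  then have "(\<lambda>x. ennreal (w x)) \<in> RH s"
    using RHb by (auto simp: RH_def)
  then show ?thesis
    by (rule that[OF _ _ w D major' w_fin]) simp
qed

section \<open>Log-Hoelder exponents\<close>

text \<open>
  The set where the inequality fails is open and null, hence empty.
\<close>

lemma AE_ge_imp_continuous_ge:
  fixes h :: "'a::euclidean_space \<Rightarrow> real"
  assumes h: "continuous_on UNIV h" and AE: "AE x in lebesgue. a \<le> h x"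
  shows "a \<le> h x"
proof (rule ccontr)
  assume "\<not> a \<le> h x"
  then have "x \<in> {x. h x < a}" by simp
  then have ne: "{x. h x < a} \<noteq> {}" by blast
  obtain N where N: "{x \<in> space lebesgue. \<not> a \<le> h x} \<subseteq> N" "emeasure lebesgue N = 0" "N \<in> sets lebesgue"
    using AE by (rule AE_E)
  have "negligible N"
    using N by (simp add: negligible_iff_null_sets null_sets_def)
  then have "negligible {x. h x < a}"
    by (rule negligible_subset) (use N(1) in auto)
  moreover have "open {x. h x < a}"
    using h by (intro open_Collect_less) auto
  ultimately show False using ne open_not_negligible by blast
qed

lemma LH_imp_continuous:
  assumes "r \<in> LH"
  shows "continuous_on UNIV r"
proof -
  obtain C0 where C0: "\<And>x y. x \<noteq> y \<Longrightarrow> norm (x - y) < 1 / 2 \<Longrightarrow> \<bar>r x - r y\<bar> \<le> C0 / (- ln (norm (x - y)))"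
    using assms by (auto simp: LH_def)
  have "(r \<longlongrightarrow> r x) (at x)" for x
  proof -
    have nrm: "filterlim (\<lambda>y. norm (x - y)) (at_right 0) (at x)"
    proof -
      have "((\<lambda>y. norm (x - y)) \<longlongrightarrow> norm (x - x)) (at x)" by (intro tendsto_intros)
      moreover have "eventually (\<lambda>y. 0 < norm (x - y)) (at x)"
        by (auto simp: eventually_at_filter)
      ultimately show ?thesis
        by (auto simp: filterlim_at elim: eventually_mono)
    qed
    have "filterlim (\<lambda>y. - ln (norm (x - y))) at_top (at x)"
      using filterlim_compose[OF ln_at_0 nrm] by (simp add: filterlim_uminus_at_bot)
    then have lim: "((\<lambda>y. C0 / (- ln (norm (x - y)))) \<longlongrightarrow> 0) (at x)"
      by (intro tendsto_divide_0[OF tendsto_const] filterlim_at_top_imp_at_infinity)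
    have "eventually (\<lambda>y. norm (x - y) < 1 / 2) (at x)"
      by (auto simp: eventually_at dist_norm norm_minus_commute intro!: exI[of _ "1 / 2"])
    moreover have "eventually (\<lambda>y. y \<noteq> x) (at x)" by (simp add: eventually_at_filter)
    ultimately have "eventually (\<lambda>y. norm (r y - r x) \<le> C0 / (- ln (norm (x - y)))) (at x)"
    proof eventually_elim
      case (elim y)
      then show ?case using C0[of x y] abs_minus_commute[of "r x" "r y"] by simp
    qed
    then have "((\<lambda>y. r y - r x) \<longlongrightarrow> 0) (at x)"
      using lim by (rule Lim_null_comparison)
    then show ?thesis by (simp add: Lim_null[symmetric])
  qed
  then show ?thesis by (simp add: continuous_on_def)
qed

text \<open>
  Applied to \<open>h u = 1 - p / u\<close>, which is Lipschitz away from \<open>0\<close>, it transfers the condition from \<open>r\<close> to \<open>\<beta>\<close>.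
\<close>

lemma LH_compose_Lipschitz:
  assumes r: "r \<in> LH" and a: "\<And>x. a \<le> r x" and L: "0 \<le> L"
    and lip: "\<And>u v. a \<le> u \<Longrightarrow> a \<le> v \<Longrightarrow> \<bar>h u - h v\<bar> \<le> L * \<bar>u - v\<bar>"
  shows "(\<lambda>x. h (r x)) \<in> LH"
proof -
  obtain C0 where C0: "\<And>x y. x \<noteq> y \<Longrightarrow> norm (x - y) < 1 / 2 \<Longrightarrow> \<bar>r x - r y\<bar> \<le> C0 / (- ln (norm (x - y)))"
    using r by (auto simp: LH_def)
  obtain Ci ri where Ci: "\<And>x. \<bar>r x - ri\<bar> \<le> Ci / ln (exp 1 + norm x)"
    using r by (auto simp: LH_def)
  have "\<bar>h (r x) - h (r y)\<bar> \<le> (L * C0) / (- ln (norm (x - y)))" if "x \<noteq> y" "norm (x - y) < 1 / 2" for x y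
    using order.trans[OF lip[OF a a] mult_left_mono[OF C0[OF that] L]] by simp
  \<comment> \<open>the limit of \<open>r\<close> is moved into the domain of the Lipschitz condition\<close>
  moreover have "\<bar>h (r x) - h (max a ri)\<bar> \<le> (L * Ci) / ln (exp 1 + norm x)" for x
  proof -
    have "\<bar>r x - max a ri\<bar> \<le> \<bar>r x - ri\<bar>"
      using a[of x] by (auto simp: max_def)
    then have "\<bar>r x - max a ri\<bar> \<le> Ci / ln (exp 1 + norm x)"
      using Ci[of x] by linarith
    then show ?thesis
      using order.trans[OF lip[OF a] mult_left_mono[OF _ L], of "max a ri" x "Ci / ln (exp 1 + norm x)"] by simp
  qed
  ultimately show ?thesis
    unfolding LH_def by blast
qed

text \<open>
  The essential bounds hold at every point, because functions in \<^const>\<open>LH\<close> are continuous.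
\<close>

lemma exponent_bounds:
  assumes LH: "r \<in> LH" and lo: "ereal p < p_minus r" and hi: "p_plus r < ereal q"
    and [measurable]: "r \<in> borel_measurable lebesgue"
  obtains a b where "p < a" "b < q" "\<And>x. a \<le> r x" "\<And>x. r x \<le> b"
proof -
  obtain a where a: "p < a" "ereal a < p_minus r"
    using ereal_dense2[OF lo] by auto
  obtain b where b: "b < q" "p_plus r < ereal b"
    using ereal_dense2[OF hi] by auto
  have "AE x in lebesgue. a \<le> r x"
    using esssup_AE[of "\<lambda>x. - ereal (r x)" lebesgue]
  proof eventually_elim
    fix x assume "- ereal (r x) \<le> esssup lebesgue (\<lambda>x. - ereal (r x))"
    then have "p_minus r \<le> ereal (r x)"
      by (simp add: p_minus_def ereal_uminus_le_reorder)
    then show "a \<le> r x" using a(2) by (simp add: less_le_trans less_imp_le flip: ereal_less_eq(3))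
  qed
  then have "a \<le> r x" for x
    by (rule AE_ge_imp_continuous_ge[OF LH_imp_continuous[OF LH]])
  moreover have "AE x in lebesgue. - b \<le> - r x"
    using esssup_AE[of "\<lambda>x. ereal (r x)" lebesgue]
  proof eventually_elim
    fix x assume "ereal (r x) \<le> esssup lebesgue (\<lambda>x. ereal (r x))"
    then have "ereal (r x) \<le> p_plus r" by (simp add: p_plus_def)
    then have "ereal (r x) \<le> ereal b" using b(2) by (metis le_less_trans less_imp_le)
    then show "- b \<le> - r x" by simp
  qed
  then have "- b \<le> - r x" for x
    by (rule AE_ge_imp_continuous_ge[rotated]) (intro continuous_on_minus LH_imp_continuous LH)
  ultimately show ?thesis using that[of a b] a b by simp
qed

section \<open>Modulars and duality\<close>

lemma modular_le_1:
  assumes "variable_norm r f < ennreal l" and "\<And>x. 0 \<le> r x"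
  shows "(\<integral>\<^sup>+x. ennpow (f x / ennreal l) (r x) \<partial>lebesgue) \<le> 1"
proof -
  obtain l' where l': "0 < l'" "(\<integral>\<^sup>+x. ennpow (f x / ennreal l') (r x) \<partial>lebesgue) \<le> 1" "ennreal l' < ennreal l"
    using assms(1) by (auto simp: variable_norm_def Inf_less_iff)
  have "(\<integral>\<^sup>+x. ennpow (f x / ennreal l) (r x) \<partial>lebesgue) \<le> (\<integral>\<^sup>+x. ennpow (f x / ennreal l') (r x) \<partial>lebesgue)"
    using assms(2) l'(1,3)
    by (intro nn_integral_mono ennpow_mono)
       (auto simp: divide_ennreal_def ennreal_less_iff inverse_ennreal intro!: mult_left_mono ennreal_leI le_imp_inverse_le)
  then show ?thesis using l'(2) by simp
qed

lemma modular_gt_1: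
  assumes "ennreal l < variable_norm r f" "0 < l"
  shows "1 < (\<integral>\<^sup>+x. ennpow (f x / ennreal l) (r x) \<partial>lebesgue)"
proof (rule ccontr)
  assume "\<not> ?thesis"
  then have "variable_norm r f \<le> ennreal l"
    unfolding variable_norm_def using assms(2) by (intro Inf_lower) auto
  then show False using assms(1) by simp
qed

text \<open>
  If \<open>\<kappa> y\<^sup>r\<close> is below the power \<open>1 / \<beta>\<close> of \<open>w\<close>, with \<open>\<beta> = 1 - p / r\<close>, then \<open>w\<close> is above \<open>\<kappa>\<^sup>\<beta> y\<^sup>r\<^sup>-\<^sup>p\<close>, since \<open>r \<beta> = r - p\<close>; for
  \<open>\<kappa> \<le> 1\<close> and \<open>\<beta> \<le> 1\<close> this is at least \<open>\<kappa> y\<^sup>r\<^sup>-\<^sup>p\<close>.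
\<close>

lemma duality_lower_bound:
  fixes y w \<kappa> r p :: real
  assumes y: "0 \<le> y" and w: "0 < w" and \<kappa>: "0 < \<kappa>" "\<kappa> \<le> 1" and p: "0 < p" "p < r"
    and le: "\<kappa> * y powr r \<le> w powr (1 / (1 - p / r))"
  shows "\<kappa> * y powr r \<le> y powr p * w"
proof (cases "y = 0")
  case False
  define \<beta> where "\<beta> = 1 - p / r"
  have \<beta>: "0 < \<beta>" "\<beta> \<le> 1" "r * \<beta> = r - p" using p by (auto simp: \<beta>_def field_simps)
  have "\<kappa> * y powr (r - p) \<le> \<kappa> powr \<beta> * (y powr r) powr \<beta>"
    using powr_mono'[of \<beta> 1 \<kappa>] \<kappa> \<beta> by (intro mult_mono) (auto simp: powr_powr)
  also have "\<dots> = (\<kappa> * y powr r) powr \<beta>"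
    by (rule powr_mult[symmetric])
  also have "\<dots> \<le> (w powr (1 / \<beta>)) powr \<beta>"
    using le \<kappa> \<beta> by (intro powr_mono2) (auto simp: \<beta>_def)
  also have "\<dots> = w"
    using \<beta> w by (simp add: powr_powr)
  finally have "y powr p * (\<kappa> * y powr (r - p)) \<le> y powr p * w"
    by (rule mult_left_mono) simp
  moreover have "y powr p * (\<kappa> * y powr (r - p)) = \<kappa> * y powr r"
    using False by (simp add: powr_diff)
  ultimately show ?thesis by simp
qed simp

text \<open>
  Young's inequality for the conjugate exponents \<open>r / p\<close> and \<open>r / (r - p)\<close>, up to constants: either \<open>w \<le> y\<^sup>r\<^sup>-\<^sup>p\<close>, and the first
  term suffices, or \<open>y\<close> is less than the power \<open>1 / (r - p)\<close> of \<open>w\<close>, and the second does.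
\<close>

lemma duality_upper_bound:
  fixes y w r p :: real
  assumes y: "0 \<le> y" and w: "0 < w" and p: "0 < p" "p < r"
  shows "y powr p * w \<le> y powr r + w powr (1 / (1 - p / r))"
proof (cases "w \<le> y powr (r - p)")
  case True
  then have "y powr p * w \<le> y powr p * y powr (r - p)"
    by (intro mult_left_mono) auto
  also have "\<dots> = y powr r" by (simp flip: powr_add)
  finally show ?thesis by (simp add: add_increasing2)
next
  case False
  have "y powr p = (y powr (r - p)) powr (p / (r - p))"
    using p by (simp add: powr_powr)
  also have "\<dots> \<le> w powr (p / (r - p))"
    using False p by (intro powr_mono2) auto
  finally have "y powr p * w \<le> w powr (p / (r - p)) * w powr 1"
    using w by (simp add: mult_right_mono)
  also have "\<dots> = w powr (p / (r - p) + 1)"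
    by (rule powr_add[symmetric])
  also have "p / (r - p) + 1 = 1 / (1 - p / r)"
    using p by (simp add: field_simps)
  finally show ?thesis by (simp add: add_increasing)
qed

lemma weighted_norm_le_imp_integral_le:
  assumes p: "0 < p" and N: "0 \<le> N" and le: "weighted_norm p w f \<le> ennreal N * weighted_norm p w g"
  shows "(\<integral>\<^sup>+x. ennpow (f x) p * w x \<partial>lebesgue) \<le> ennreal (N powr p) * (\<integral>\<^sup>+x. ennpow (g x) p * w x \<partial>lebesgue)"
proof -
  have "ennpow (weighted_norm p w f) p \<le> ennpow (ennreal N * weighted_norm p w g) p"
    using p le by (intro ennpow_mono) auto
  then show ?thesis
    using p N by (simp add: weighted_norm_def ennpow_mult ennpow_ennpow ennpow_ennreal)
qed

lemma ennreal_divide_mult_cancel: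
  "0 < l \<Longrightarrow> ennreal l * (x / ennreal l) = x"
  by (cases x) (auto simp: divide_ennreal ennreal_top_divide ennreal_mult_top simp flip: ennreal_mult)

text \<open>
  A failure of the norm inequality is expressed by modulars: any level \<open>c m\<close> between \<open>\<parallel>f\<parallel> / 2\<close> and \<open>\<parallel>f\<parallel>\<close> that also
  exceeds \<open>c \<parallel>g\<parallel>\<close> will do. As the levels stay strictly on one side of each norm, the bounds on the modulars
  follow from the definition of the norm as an infimum, attained or not.
\<close>

lemma separating_levels:
  assumes c: "0 < c" and r: "\<And>x. 0 \<le> r x"
    and fin: "variable_norm r f < \<infinity>" and gt: "\<not> variable_norm r f \<le> ennreal c * variable_norm r g"
  obtains m where "0 < m" "1 < (\<integral>\<^sup>+x. ennpow (f x / ennreal (c * m)) (r x) \<partial>lebesgue)"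
    "(\<integral>\<^sup>+x. ennpow (f x / ennreal (2 * (c * m))) (r x) \<partial>lebesgue) \<le> 1"
    "(\<integral>\<^sup>+x. ennpow (g x / ennreal m) (r x) \<partial>lebesgue) \<le> 1"
proof -
  obtain F where F: "variable_norm r f = ennreal F" "0 \<le> F"
    using fin by (cases "variable_norm r f") auto
  have lt: "ennreal c * variable_norm r g < ennreal F" using gt F by simp
  then obtain G where G: "variable_norm r g = ennreal G" "0 \<le> G"
    using c by (cases "variable_norm r g") (auto simp: ennreal_mult_top)
  have cG: "c * G < F" using lt G c F by (simp add: ennreal_less_iff flip: ennreal_mult)
  then have F_pos: "0 < F" using c G by (smt (verit) mult_nonneg_nonneg)
  obtain l where l: "max (F / 2) (c * G) < l" "l < F"
    using dense[of "max (F / 2) (c * G)" F] cG F_pos by auto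
  have l_pos: "0 < l" using l F_pos by linarith
  have m: "0 < l / c" "c * (l / c) = l" "G < l / c"
    using c l l_pos by (auto simp: field_simps)
  show ?thesis
  proof (rule that[OF m(1)], unfold m(2))
    show "1 < (\<integral>\<^sup>+x. ennpow (f x / ennreal l) (r x) \<partial>lebesgue)"
      using F l l_pos by (intro modular_gt_1) (auto simp: ennreal_less_iff)
    show "(\<integral>\<^sup>+x. ennpow (f x / ennreal (2 * l)) (r x) \<partial>lebesgue) \<le> 1"
      using F l by (intro modular_le_1 r) (auto simp: ennreal_less_iff)
    show "(\<integral>\<^sup>+x. ennpow (g x / ennreal (l / c)) (r x) \<partial>lebesgue) \<le> 1"
      using G m by (intro modular_le_1 r) (auto simp: ennreal_less_iff)
  qed
qed

text \<open>
  Together with the bound at level \<open>2 l\<close> from the preceding lemma it keeps the modular at level \<open>l\<close> bounded.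
\<close>

lemma modular_doubling:
  assumes l: "0 < l" and r: "\<And>x. 0 < r x" "\<And>x. r x \<le> b"
    and [measurable]: "f \<in> borel_measurable lebesgue" "r \<in> borel_measurable lebesgue"
  shows "(\<integral>\<^sup>+x. ennpow (f x / ennreal l) (r x) \<partial>lebesgue)
    \<le> ennreal (2 powr b) * (\<integral>\<^sup>+x. ennpow (f x / ennreal (2 * l)) (r x) \<partial>lebesgue)"
proof -
  have "(\<integral>\<^sup>+x. ennpow (f x / ennreal l) (r x) \<partial>lebesgue)
      \<le> (\<integral>\<^sup>+x. ennreal (2 powr b) * ennpow (f x / ennreal (2 * l)) (r x) \<partial>lebesgue)"
  proof (rule nn_integral_mono)
    fix x
    have "f x / ennreal l = ennreal 2 * (f x / ennreal (2 * l))"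
      using l by (cases "f x") (auto simp: divide_ennreal ennreal_top_divide ennreal_mult_top simp del: ennreal_numeral simp flip: ennreal_mult)
    then have "ennpow (f x / ennreal l) (r x) = ennreal (2 powr r x) * ennpow (f x / ennreal (2 * l)) (r x)"
      using r(1)[of x] by (simp add: ennpow_mult ennpow_ennreal del: ennreal_numeral)
    also have "\<dots> \<le> ennreal (2 powr b) * ennpow (f x / ennreal (2 * l)) (r x)"
      using r(2)[of x] by (intro mult_right_mono ennreal_leI powr_mono) auto
    finally show "ennpow (f x / ennreal l) (r x) \<le> ennreal (2 powr b) * ennpow (f x / ennreal (2 * l)) (r x)" .
  qed
  also have "\<dots> = ennreal (2 powr b) * (\<integral>\<^sup>+x. ennpow (f x / ennreal (2 * l)) (r x) \<partial>lebesgue)"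
    by (rule nn_integral_cmult) measurable
  finally show ?thesis .
qed

section \<open>Extrapolation\<close>

theorem theorem3p3:
  fixes p q :: real
    and \<F> :: "((real ^ 'n \<Rightarrow> ennreal) \<times> (real ^ 'n \<Rightarrow> ennreal)) set"
  assumes "0 < p" and "p < q"
    and "\<forall>(f, g)\<in>\<F>. f \<in> borel_measurable lebesgue \<and> g \<in> borel_measurable lebesgue"
    and "\<exists>N :: real \<Rightarrow> real. \<forall>w\<in>RH (conj_exponent (q / p)).
           family_bound \<F> (weighted_norm p w) (weighted_norm p w)
             (N (RH_const (conj_exponent (q / p)) w))"
  shows "\<forall>r\<in>exponents0.
           ereal p < p_minus r \<and> p_minus r \<le> p_plus r \<and> p_plus r < ereal q \<and> r \<in> LH \<longrightarrow>
           (\<exists>C. family_bound \<F> (variable_norm r) (variable_norm r) C)"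
proof (intro ballI impI, elim conjE)
  fix r :: "real ^ 'n \<Rightarrow> real"
  assume r0: "r \<in> exponents0" and lo: "ereal p < p_minus r" and hi: "p_plus r < ereal q" and LH: "r \<in> LH"
  have rm [measurable]: "r \<in> borel_measurable lebesgue" using r0 by (simp add: exponents0_def)
  obtain a b where ab: "p < a" "b < q" and r: "\<And>x. a \<le> r x" "\<And>x. r x \<le> b"
    using exponent_bounds[OF LH lo hi rm] by blast
  have p: "0 < p" by fact
  have r_pos: "0 < r x" and r_p: "p < r x" for x using r(1)[of x] ab p by auto
  have b: "a \<le> b" using r(1)[of 0] r(2)[of 0] by linarith
  define s where "s = conj_exponent (q / p)"
  have s: "1 < s" "1 / s = 1 - p / q"
    using p \<open>p < q\<close> by (auto simp: s_def conj_exponent_def field_simps)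
  define \<beta> where "\<beta> x = 1 - p / r x" for x
  have \<beta>LH: "\<beta> \<in> LH"
    unfolding \<beta>_def
  proof (rule LH_compose_Lipschitz[OF LH r(1), where L = "p / (a * a)"])
    fix u v :: real assume uv: "a \<le> u" "a \<le> v"
    have "\<bar>(1 - p / u) - (1 - p / v)\<bar> = p / (u * v) * \<bar>u - v\<bar>"
    proof -
      have "(1 - p / u) - (1 - p / v) = p / (u * v) * (u - v)"
        using uv ab p by (simp add: field_simps)
      then show ?thesis using uv ab p by (simp add: abs_mult)
    qed
    also have "\<dots> \<le> p / (a * a) * \<bar>u - v\<bar>"
      using uv ab p by (intro mult_right_mono frac_le mult_mono) auto
    finally show "\<bar>(1 - p / u) - (1 - p / v)\<bar> \<le> p / (a * a) * \<bar>u - v\<bar>" .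
  qed (use p in auto)
  show "\<exists>C. family_bound \<F> (variable_norm r) (variable_norm r) C"
  proof (rule ccontr)
    assume contra: "\<not> ?thesis"
    \<comment> \<open>\<open>c\<^sup>p = 4\<^sup>k\<close> outgrows the factor \<open>2\<^sup>k\<close> lost by combining all test functions in one series\<close>
    define c where "c k = 4 powr (real k / p)" for k :: nat
    have c: "0 < c k" "c k powr p = 4 ^ k" for k
      using p by (auto simp: c_def powr_powr powr_realpow)
    define counterexample where "counterexample k = (\<lambda>(f, g, m). (f, g) \<in> \<F> \<and> 0 < m
      \<and> 1 < (\<integral>\<^sup>+x. ennpow (f x / ennreal (c k * m)) (r x) \<partial>lebesgue)
      \<and> (\<integral>\<^sup>+x. ennpow (f x / ennreal (2 * (c k * m))) (r x) \<partial>lebesgue) \<le> 1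
      \<and> (\<integral>\<^sup>+x. ennpow (g x / ennreal m) (r x) \<partial>lebesgue) \<le> 1)" for k
    have "\<exists>t. counterexample k t" for k
    proof -
      have "\<not> family_bound \<F> (variable_norm r) (variable_norm r) (c k)"
        using contra by blast
      then obtain f g where fg: "(f, g) \<in> \<F>" "variable_norm r f < \<infinity>"
          "\<not> variable_norm r f \<le> ennreal (c k) * variable_norm r g"
        using c(1)[of k] by (auto simp: family_bound_def)
      obtain m where "0 < m" "1 < (\<integral>\<^sup>+x. ennpow (f x / ennreal (c k * m)) (r x) \<partial>lebesgue)"
          "(\<integral>\<^sup>+x. ennpow (f x / ennreal (2 * (c k * m))) (r x) \<partial>lebesgue) \<le> 1"
          "(\<integral>\<^sup>+x. ennpow (g x / ennreal m) (r x) \<partial>lebesgue) \<le> 1"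
        by (rule separating_levels[OF c(1) less_imp_le[OF r_pos] fg(2,3)])
      with fg(1) have "counterexample k (f, g, m)" by (simp add: counterexample_def)
      then show ?thesis by blast
    qed
    then obtain T where T: "\<And>k. counterexample k (T k)" by metis
    define f g m where "f k = fst (T k)" and "g k = fst (snd (T k))" and "m k = snd (snd (T k))" for k
    have fgm: "counterexample k (f k, g k, m k)" for k
      using T[of k] by (simp add: f_def g_def m_def)
    have fg: "\<And>k. (f k, g k) \<in> \<F>" and m: "\<And>k :: nat. 0 < m k"
      and f_gt: "\<And>k. 1 < (\<integral>\<^sup>+x. ennpow (f k x / ennreal (c k * m k)) (r x) \<partial>lebesgue)"
      and f_le: "\<And>k. (\<integral>\<^sup>+x. ennpow (f k x / ennreal (2 * (c k * m k))) (r x) \<partial>lebesgue) \<le> 1"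
      and g_le: "\<And>k. (\<integral>\<^sup>+x. ennpow (g k x / ennreal (m k)) (r x) \<partial>lebesgue) \<le> 1"
      using fgm by (simp_all add: counterexample_def)
    have [measurable]: "f k \<in> borel_measurable lebesgue" "g k \<in> borel_measurable lebesgue" for k
      using fg[of k] assms(3) by auto
    define \<phi> where "\<phi> k x = f k x / ennreal (c k * m k)" for k x
    define \<psi> where "\<psi> k x = g k x / ennreal (m k)" for k x
    have [measurable]: "\<phi> k \<in> borel_measurable lebesgue" "\<psi> k \<in> borel_measurable lebesgue" for k
      unfolding \<phi>_def \<psi>_def by measurable
    have cm: "0 < c k * m k" for k using c m by simp
    have \<phi>_le: "(\<integral>\<^sup>+x. ennpow (\<phi> k x) (r x) \<partial>lebesgue) \<le> ennreal (2 powr b)" for k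
    proof -
      have "(\<integral>\<^sup>+x. ennpow (\<phi> k x) (r x) \<partial>lebesgue)
          \<le> ennreal (2 powr b) * (\<integral>\<^sup>+x. ennpow (f k x / ennreal (2 * (c k * m k))) (r x) \<partial>lebesgue)"
        unfolding \<phi>_def by (intro modular_doubling cm r_pos r) measurable
      also have "\<dots> \<le> ennreal (2 powr b) * 1"
        by (intro mult_left_mono f_le) auto
      finally show ?thesis by simp
    qed
    \<comment> \<open>one majorant for all \<open>k\<close>, so that a single weight tests every pair\<close>
    define H where "H x = (\<Sum>k. ennreal ((1/2) ^ k) * ennpow (\<phi> k x) (r x))" for x
    have H_meas: "H \<in> borel_measurable lebesgue" unfolding H_def by measurable
    have H_fin: "(\<integral>\<^sup>+x. H x \<partial>lebesgue) < \<infinity>"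
    proof -
      have "(\<integral>\<^sup>+x. H x \<partial>lebesgue) = (\<Sum>k. \<integral>\<^sup>+x. ennreal ((1/2) ^ k) * ennpow (\<phi> k x) (r x) \<partial>lebesgue)"
        unfolding H_def by (rule nn_integral_suminf) measurable
      also have "\<dots> = (\<Sum>k. ennreal ((1/2) ^ k) * (\<integral>\<^sup>+x. ennpow (\<phi> k x) (r x) \<partial>lebesgue))"
        by (subst nn_integral_cmult) auto
      also have "\<dots> \<le> (\<Sum>k. ennreal ((1/2) ^ k) * ennreal (2 powr b))"
        by (intro suminf_le mult_left_mono \<phi>_le) auto
      also have "\<dots> = 2 * ennreal (2 powr b)"
        by (simp only: ennreal_suminf_multc ennreal_suminf_half)
      also have "\<dots> < \<infinity>" by (simp add: ennreal_mult_less_top)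
      finally show ?thesis .
    qed
    have \<beta>m: "\<beta> \<in> borel_measurable lebesgue" unfolding \<beta>_def by measurable
    have b01: "0 < 1 - p / a" "1 - p / b < 1 / s"
      using ab p b by (auto simp: s(2) intro!: divide_strict_left_mono)
    have \<beta>: "1 - p / a \<le> \<beta> x" "\<beta> x \<le> 1 - p / b" for x
      using r[of x] ab p r_pos[of x] b by (auto simp: \<beta>_def intro!: divide_left_mono)
    obtain w :: "real ^ 'n \<Rightarrow> real" and D where w_RH: "(\<lambda>x. ennreal (w x)) \<in> RH s"
      and [measurable]: "w \<in> borel_measurable lebesgue" and w: "\<And>x. 0 < w x" and D: "1 \<le> D"
      and H_le: "AE x in lebesgue. H x \<le> ennreal (D * w x powr (1 / \<beta> x))"
      and w_fin: "(\<integral>\<^sup>+x. ennreal (w x powr (1 / \<beta> x)) \<partial>lebesgue) < \<infinity>"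
      using reverse_hoelder_majorant[OF s(1) \<beta>m b01 \<beta> \<beta>LH H_meas H_fin] by blast
    obtain J where J: "0 \<le> J" "(\<integral>\<^sup>+x. ennreal (w x powr (1 / \<beta> x)) \<partial>lebesgue) = ennreal J"
      using w_fin by (cases "\<integral>\<^sup>+x. ennreal (w x powr (1 / \<beta> x)) \<partial>lebesgue") auto
    obtain N where N: "family_bound \<F> (weighted_norm p (\<lambda>x. ennreal (w x))) (weighted_norm p (\<lambda>x. ennreal (w x))) N"
      using assms(4) w_RH by (auto simp: s_def)
    have N_pos: "0 < N" using N by (simp add: family_bound_def)
    note [measurable] = \<beta>m
    have upper: "(\<integral>\<^sup>+x. ennpow (h x) p * ennreal (w x) \<partial>lebesgue) \<le> (\<integral>\<^sup>+x. ennpow (h x) (r x) \<partial>lebesgue) + ennreal J"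
      if [measurable]: "h \<in> borel_measurable lebesgue" for h
    proof -
      have "(\<integral>\<^sup>+x. ennpow (h x) p * ennreal (w x) \<partial>lebesgue)
          \<le> (\<integral>\<^sup>+x. ennpow (h x) (r x) + ennreal (w x powr (1 / \<beta> x)) \<partial>lebesgue)"
      proof (rule nn_integral_mono)
        fix x
        show "ennpow (h x) p * ennreal (w x) \<le> ennpow (h x) (r x) + ennreal (w x powr (1 / \<beta> x))"
        proof (cases "h x")
          case (real y)
          then show ?thesis
            using duality_upper_bound[OF real(1) w p r_p, of x x] w[of x]
            by (simp add: ennpow_ennreal \<beta>_def flip: ennreal_mult ennreal_plus)
        qed simp
      qed
      also have "\<dots> = (\<integral>\<^sup>+x. ennpow (h x) (r x) \<partial>lebesgue) + ennreal J"
        by (subst nn_integral_add) (auto simp: J(2))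
      finally show ?thesis .
    qed
    have key: "2 ^ k \<le> D * N powr p * (1 + J)" for k
    proof -
      \<comment> \<open>\<open>\<kappa>\<close> collects the coefficient of the \<open>k\<close>-th term in \<open>H\<close> and the constant of the majorant\<close>
      define \<kappa> where "\<kappa> = (1/2) ^ k / D"
      have \<kappa>: "0 < \<kappa>" "\<kappa> \<le> 1"
      proof -
        have "(1/2 :: real) ^ k \<le> 1" by (intro power_le_one) auto
        then have "(1/2 :: real) ^ k \<le> D" using D by linarith
        then show "\<kappa> \<le> 1" using D by (simp add: \<kappa>_def divide_le_eq_1)
        show "0 < \<kappa>" using D by (simp add: \<kappa>_def)
      qed
      have pt: "AE x in lebesgue. ennreal \<kappa> * ennpow (\<phi> k x) (r x) \<le> ennpow (\<phi> k x) p * ennreal (w x)"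
        using H_le
      proof eventually_elim
        fix x assume "H x \<le> ennreal (D * w x powr (1 / \<beta> x))"
        then have le: "ennreal ((1/2) ^ k) * ennpow (\<phi> k x) (r x) \<le> ennreal (D * w x powr (1 / \<beta> x))"
          unfolding H_def using order.trans[OF ennreal_le_suminf] by blast
        show "ennreal \<kappa> * ennpow (\<phi> k x) (r x) \<le> ennpow (\<phi> k x) p * ennreal (w x)"
        proof (cases "\<phi> k x")
          case (real y)
          have "(1/2) ^ k * y powr r x \<le> D * w x powr (1 / \<beta> x)"
            using le real D by (simp add: ennpow_ennreal flip: ennreal_mult)
          then have "\<kappa> * y powr r x \<le> w x powr (1 / \<beta> x)"
            using D by (simp add: \<kappa>_def field_simps)
          then have "\<kappa> * y powr r x \<le> y powr p * w x"
            by (intro duality_lower_bound real(1) w \<kappa> p r_p) (simp add: \<beta>_def)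
          then show ?thesis
            using real \<kappa> w[of x] by (simp add: ennpow_ennreal flip: ennreal_mult)
        next
          case top
          then show ?thesis using le by (simp add: ennreal_mult_top top_unique)
        qed
      qed
      have "ennreal \<kappa> \<le> ennreal \<kappa> * (\<integral>\<^sup>+x. ennpow (\<phi> k x) (r x) \<partial>lebesgue)"
        using f_gt[of k] mult_left_mono[of 1 "\<integral>\<^sup>+x. ennpow (\<phi> k x) (r x) \<partial>lebesgue" "ennreal \<kappa>"]
        by (simp add: \<phi>_def)
      also have "\<dots> = (\<integral>\<^sup>+x. ennreal \<kappa> * ennpow (\<phi> k x) (r x) \<partial>lebesgue)"
        by (rule nn_integral_cmult[symmetric]) measurable
      also have "\<dots> \<le> (\<integral>\<^sup>+x. ennpow (\<phi> k x) p * ennreal (w x) \<partial>lebesgue)"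
        using pt by (rule nn_integral_mono_AE)
      finally have \<phi>_low: "ennreal \<kappa> \<le> (\<integral>\<^sup>+x. ennpow (\<phi> k x) p * ennreal (w x) \<partial>lebesgue)" .
      have scale: "(\<integral>\<^sup>+x. ennpow (h x) p * ennreal (w x) \<partial>lebesgue)
          = ennreal (l powr p) * (\<integral>\<^sup>+x. ennpow (h x / ennreal l) p * ennreal (w x) \<partial>lebesgue)"
        if l: "0 < l" and [measurable]: "h \<in> borel_measurable lebesgue" for h l
      proof -
        have "ennpow (h x) p = ennreal (l powr p) * ennpow (h x / ennreal l) p" for x
        proof -
          have "ennpow (ennreal l * (h x / ennreal l)) p = ennreal (l powr p) * ennpow (h x / ennreal l) p"
            using l p by (simp only: ennpow_mult ennpow_ennreal less_imp_le)
          then show ?thesis by (simp only: ennreal_divide_mult_cancel[OF l])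
        qed
        then have "(\<integral>\<^sup>+x. ennpow (h x) p * ennreal (w x) \<partial>lebesgue)
            = (\<integral>\<^sup>+x. ennreal (l powr p) * (ennpow (h x / ennreal l) p * ennreal (w x)) \<partial>lebesgue)"
          by (simp only: mult.assoc)
        also have "\<dots> = ennreal (l powr p) * (\<integral>\<^sup>+x. ennpow (h x / ennreal l) p * ennreal (w x) \<partial>lebesgue)"
          by (rule nn_integral_cmult) measurable
        finally show ?thesis .
      qed
      have f_eq: "(\<integral>\<^sup>+x. ennpow (f k x) p * ennreal (w x) \<partial>lebesgue)
          = ennreal ((c k * m k) powr p) * (\<integral>\<^sup>+x. ennpow (\<phi> k x) p * ennreal (w x) \<partial>lebesgue)"
        unfolding \<phi>_def by (intro scale cm) measurable
      have g_eq: "(\<integral>\<^sup>+x. ennpow (g k x) p * ennreal (w x) \<partial>lebesgue)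
          = ennreal (m k powr p) * (\<integral>\<^sup>+x. ennpow (\<psi> k x) p * ennreal (w x) \<partial>lebesgue)"
        unfolding \<psi>_def by (intro scale m) measurable
      have "(\<integral>\<^sup>+x. ennpow (\<phi> k x) p * ennreal (w x) \<partial>lebesgue) < \<infinity>"
        using upper[of "\<phi> k"] \<phi>_le[of k] by (auto simp: less_top[symmetric] top_unique)
      then have "(\<integral>\<^sup>+x. ennpow (f k x) p * ennreal (w x) \<partial>lebesgue) < \<infinity>"
        unfolding f_eq by (simp add: ennreal_mult_less_top)
      then have "weighted_norm p (\<lambda>x. ennreal (w x)) (f k) < \<infinity>"
        by (simp add: weighted_norm_def ennpow_def)
      then have "weighted_norm p (\<lambda>x. ennreal (w x)) (f k) \<le> ennreal N * weighted_norm p (\<lambda>x. ennreal (w x)) (g k)"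
        using N fg[of k] by (auto simp: family_bound_def)
      then have main: "ennreal ((c k * m k) powr p) * (\<integral>\<^sup>+x. ennpow (\<phi> k x) p * ennreal (w x) \<partial>lebesgue)
          \<le> ennreal (N powr p) * (ennreal (m k powr p) * (\<integral>\<^sup>+x. ennpow (\<psi> k x) p * ennreal (w x) \<partial>lebesgue))"
        unfolding f_eq[symmetric] g_eq[symmetric]
        by (rule weighted_norm_le_imp_integral_le[OF p less_imp_le[OF N_pos]])
      have \<psi>_up: "(\<integral>\<^sup>+x. ennpow (\<psi> k x) p * ennreal (w x) \<partial>lebesgue) \<le> ennreal (1 + J)"
        using order.trans[OF upper[of "\<psi> k"] add_right_mono[OF g_le[of k, folded \<psi>_def]]] J(1)
        by simp
      have "ennreal ((c k * m k) powr p * \<kappa>) = ennreal ((c k * m k) powr p) * ennreal \<kappa>"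
        using \<kappa> by (simp add: ennreal_mult)
      also have "\<dots> \<le> ennreal (N powr p) * (ennreal (m k powr p) * (\<integral>\<^sup>+x. ennpow (\<psi> k x) p * ennreal (w x) \<partial>lebesgue))"
        using main mult_left_mono[OF \<phi>_low] by (rule order.trans[rotated]) simp
      also have "\<dots> \<le> ennreal (N powr p) * (ennreal (m k powr p) * ennreal (1 + J))"
        by (intro mult_left_mono \<psi>_up) auto
      also have "\<dots> = ennreal (N powr p * (m k powr p * (1 + J)))"
        using J(1) by (simp add: ennreal_mult del: ennreal_plus)
      finally have "(c k * m k) powr p * \<kappa> \<le> N powr p * (m k powr p * (1 + J))"
        using J(1) by (simp del: ennreal_plus)
      \<comment> \<open>the powers of \<open>m k\<close> cancel: only the ratio \<open>c k\<close> of the two levels matters\<close>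
      then have "m k powr p * (4 ^ k * \<kappa>) \<le> m k powr p * (N powr p * (1 + J))"
        using c m by (simp add: powr_mult ac_simps)
      then have "4 ^ k * \<kappa> \<le> N powr p * (1 + J)"
        using m[of k] by (subst (asm) mult_le_cancel_left_pos) auto
      moreover have "4 ^ k * \<kappa> = 2 ^ k / D"
        by (simp add: \<kappa>_def flip: power_mult_distrib)
      ultimately have "2 ^ k / D \<le> N powr p * (1 + J)" by simp
      then show ?thesis using D by (simp add: pos_divide_le_eq ac_simps)
    qed
    obtain k where "D * N powr p * (1 + J) < 2 ^ k"
      using real_arch_pow[of 2 "D * N powr p * (1 + J)"] by auto
    then show False using key[of k] by simp
  qed
qed

end
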